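(* Let $S$ be a Hausdorff pseudocompact semitopological semigroup which is algebraically a primitive inverse semigroup, $S=\sum_{i\in\mathscr I}B_{\lambda_i}(G_i)$. Suppose that for every $i\in\mathscr I$ there is $\alpha_i\in\lambda_i$ such that the maximal subgroup $(G_i)_{\alpha_i,\alpha_i}$ (with the subspace topology) satisfies at least one of: (1) it is left precompact; (2) it is a pseudocompact paratopological group; (3) it is left $\omega$-precompact and pseudocompact; (4) the subsemigroup $(G_i)_{\alpha_i,\alpha_i}\cup\{0\}$ is a topological semigroup. Then: (i) every non-zero maximal subgroup of $S$ is an open-and-closed subset of $S$ and hence is pseudocompact; (ii) for every $i\in\mathscr I$ the subspace $B_{\lambda_i}(G_i)$ is pseudocompact, all subspaces $(G_i)_{\alpha,\beta}$, $\alpha,\beta\in\lambda_i$, are homeomorphic, and all $(G_i)_{\alpha,\alpha}$ are topologically isomorphic pseudocompact semitopological groups; (iii) if $\mathscr B$ is a base of the topology of $S$ at the unit $(\alpha_i,e_i,\alpha_i)$ of $(G_i)_{\alpha_i,\alpha_i}$ with $U\subseteq(G_i)_{\alpha_i,\alpha_i}$ for all $U\in\mathscr B$, then for all $\beta_i,\gamma_i\in\lambda_i$ and $x\in G_i$ the family $\{(\beta_i,x,\alpha_i)\cdot U\cdot(\alpha_i,e_i,\gamma_i):U\in\mathscr B\}$ is a base of the topology at $(\beta_i,x,\gamma_i)$; (iv) if moreover $S$ is semiregular, then the family of all sets $S\setminus\big((G_{i_1})_{\alpha_1,\beta_1}\cup\dots\cup(G_{i_k})_{\alpha_k,\beta_k}\big)$,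 where $k\in\mathbb N$, $i_1,\dots,i_k\in\mathscr I$, $\alpha_j,\beta_j\in\lambda_{i_j}$, is a base of the topology of $S$ at zero.
   Context: All spaces are Hausdorff; a semitopological (topological) semigroup is a Hausdorff space with a separately (jointly) continuous associative operation; a semitopological group (paratopological group) is a group with Hausdorff topology and separately (jointly) continuous multiplication. Pseudocompact: every locally finite family of non-empty open sets is finite. Semiregular: having a base of regular open sets ($\operatorname{int}\operatorname{cl}A=A$). For a group $G$ and cardinal $\lambda\ge1$, $B_\lambda(G)=(\lambda\times G\times\lambda)\cup\{0\}$ with $(\alpha,a,\beta)(\gamma,b,\delta)=(\alpha,ab,\delta)$ if $\beta=\gamma$ and $0$ otherwise. The orthogonal sum of semigroups $T_\iota$ with zeros is $\{0\}\cup\bigcup_\iota(T_\iota\setminus\{0_\iota\})$ with products computed in $T_\iota$ when both factors lie in the same $T_\iota$ and the product is non-zero, and $0$ otherwise. Primitive inverse semigroups are exactly orthogonal sums $\sum_{i\in\mathscr I}B_{\lambda_i}(G_i)$; we identify $B_{\lambda_i}(G_i)$ with a subsemigroup of $S$, write $(G_i)_{\alpha,\beta}=\{(\alpha,g,\beta):g\in G_i\}$ and $e_i$ for the unit of $G_i$; the maximal subgroups of $S$ are $\{0\}$ and the $(G_i)_{\alpha,\alpha}$. Left (resp. left $\omega$-) precompact: for each neighbourhood $U$ of the unit there is a finite (resp. countable) $F$ with $FU=G$. *)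

theory Defs
  imports "HOL-Analysis.Analysis" "HOL-Algebra.Group"
begin

definition pseudocompact_space :: "'a topology \<Rightarrow> bool" where
  "pseudocompact_space X \<longleftrightarrow>
     (\<forall>\<U>. (\<forall>U\<in>\<U>. openin X U \<and> U \<noteq> {}) \<and> locally_finite_in X \<U> \<longrightarrow> finite \<U>)"

definition semiregular_space :: "'a topology \<Rightarrow> bool" where
  "semiregular_space X \<longleftrightarrow>
     (\<forall>U x. openin X U \<and> x \<in> U \<longrightarrow>
        (\<exists>V. openin X V \<and> x \<in> V \<and> V \<subseteq> U \<and> X interior_of (X closure_of V) = V))"

definition nbhd_base :: "'a topology \<Rightarrow> 'a \<Rightarrow> 'a set set \<Rightarrow> bool" where
  "nbhd_base X x \<B> \<longleftrightarrow>
     (\<forall>B\<in>\<B>. openin X B \<and> x \<in> B) \<and>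
     (\<forall>U. openin X U \<and> x \<in> U \<longrightarrow> (\<exists>B\<in>\<B>. B \<subseteq> U))"

definition semitopological_semigroup :: "'a topology \<Rightarrow> ('a \<Rightarrow> 'a \<Rightarrow> 'a) \<Rightarrow> bool" where
  "semitopological_semigroup X m \<longleftrightarrow>
     Hausdorff_space X \<and>
     (\<forall>x\<in>topspace X. \<forall>y\<in>topspace X. m x y \<in> topspace X) \<and>
     (\<forall>x\<in>topspace X. \<forall>y\<in>topspace X. \<forall>z\<in>topspace X. m (m x y) z = m x (m y z)) \<and>
     (\<forall>a\<in>topspace X. continuous_map X X (\<lambda>x. m a x) \<and> continuous_map X X (\<lambda>x. m x a))"

definition topological_semigroup :: "'a topology \<Rightarrow> ('a \<Rightarrow> 'a \<Rightarrow> 'a) \<Rightarrow> bool" where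
  "topological_semigroup X m \<longleftrightarrow>
     Hausdorff_space X \<and>
     (\<forall>x\<in>topspace X. \<forall>y\<in>topspace X. m x y \<in> topspace X) \<and>
     (\<forall>x\<in>topspace X. \<forall>y\<in>topspace X. \<forall>z\<in>topspace X. m (m x y) z = m x (m y z)) \<and>
     continuous_map (prod_topology X X) X (\<lambda>(x, y). m x y)"

definition setmult :: "('a \<Rightarrow> 'a \<Rightarrow> 'a) \<Rightarrow> 'a set \<Rightarrow> 'a set \<Rightarrow> 'a set" where
  "setmult m A B = {m a b | a b. a \<in> A \<and> b \<in> B}"

definition left_precompact :: "'a topology \<Rightarrow> 'a set \<Rightarrow> ('a \<Rightarrow> 'a \<Rightarrow> 'a) \<Rightarrow> 'a \<Rightarrow> bool" where
  "left_precompact X H m e \<longleftrightarrow>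
     (\<forall>U. openin (subtopology X H) U \<and> e \<in> U \<longrightarrow>
        (\<exists>F. finite F \<and> F \<subseteq> H \<and> setmult m F U = H))"

definition left_omega_precompact :: "'a topology \<Rightarrow> 'a set \<Rightarrow> ('a \<Rightarrow> 'a \<Rightarrow> 'a) \<Rightarrow> 'a \<Rightarrow> bool" where
  "left_omega_precompact X H m e \<longleftrightarrow>
     (\<forall>U. openin (subtopology X H) U \<and> e \<in> U \<longrightarrow>
        (\<exists>F. countable F \<and> F \<subseteq> H \<and> setmult m F U = H))"

text \<open>Elements: the zero, and triples (alpha, g, beta) in the i-th Brandt summand.\<close>
datatype ('i, 'a, 'g) bel = BZero | BEl 'i 'a 'g 'a

fun bmult :: "('i \<Rightarrow> 'g monoid) \<Rightarrow> ('i, 'a, 'g) bel \<Rightarrow> ('i, 'a, 'g) bel \<Rightarrow> ('i, 'a, 'g) bel" where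
  "bmult G (BEl i a g b) (BEl j c h d) =
     (if i = j \<and> b = c then BEl i a (g \<otimes>\<^bsub>G i\<^esub> h) d else BZero)"
| "bmult G _ _ = BZero"

definition brandt_sum :: "'i set \<Rightarrow> ('i \<Rightarrow> 'a set) \<Rightarrow> ('i \<Rightarrow> 'g monoid) \<Rightarrow> ('i, 'a, 'g) bel set" where
  "brandt_sum I \<Lambda> G = insert BZero
     {BEl i a g b | i a g b. i \<in> I \<and> a \<in> \<Lambda> i \<and> b \<in> \<Lambda> i \<and> g \<in> carrier (G i)}"

definition brandt_comp :: "('i \<Rightarrow> 'a set) \<Rightarrow> ('i \<Rightarrow> 'g monoid) \<Rightarrow> 'i \<Rightarrow> ('i, 'a, 'g) bel set" where
  "brandt_comp \<Lambda> G i = insert BZero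
     {BEl i a g b | a g b. a \<in> \<Lambda> i \<and> b \<in> \<Lambda> i \<and> g \<in> carrier (G i)}"

definition gblock :: "('i \<Rightarrow> 'g monoid) \<Rightarrow> 'i \<Rightarrow> 'a \<Rightarrow> 'a \<Rightarrow> ('i, 'a, 'g) bel set" where
  "gblock G i a b = {BEl i a g b | g. g \<in> carrier (G i)}"

end

theory Submission
  imports Defs
begin

text \<open>For an idempotent \<open>e = (\<alpha>, 1, \<alpha>)\<close> the map \<open>x \<mapsto> e x e\<close> is a continuous retraction onto the
  maximal subgroup \<open>H\<close> of \<open>e\<close> with zero adjoined, and \<open>H\<close> is the preimage of the non-zero elements,
  hence open. So everything hinges on zero being isolated in the pseudocompact space \<open>H \<union> {0}\<close>.
  If it is not, separate continuity yields points \<open>x\<close> of \<open>H\<close> for which \<open>f\<^sup>-\<^sup>1 x\<close> is near zero for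
  all \<open>f\<close> in a given finite set. This contradicts precompactness at once, and \<open>\<omega>\<close>-precompactness
  after passing to an accumulation point of open sets. In the paratopological case
  pseudocompactness makes inversion almost continuous, and in the case of a topological semigroup
  one plays off the families \<open>x\<^sub>n U\<close> and \<open>U x\<^sub>n\<^sup>-\<^sup>1\<close> for a sequence \<open>x\<^sub>n\<close> tending fast to zero.
  Closedness then spreads to all blocks by translation.\<close>

no_notation eq_closure_of (\<open>closure'_of\<index>\<close>)

section \<open>Pseudocompact spaces\<close>

text \<open>Pseudocompactness concerns sets of open sets, not indices. Without an accumulation point
  the range of \<open>P\<close> is locally finite, hence finite, so one set recurs infinitely often
  and any of its points is an accumulation point after all.\<close>

lemma pseudocompact_accumulation:
  fixes P :: "nat \<Rightarrow> 'a set"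
  assumes pc: "pseudocompact_space X"
    and P: "\<And>n. openin X (P n)" "\<And>n. P n \<noteq> {}"
  obtains z where "z \<in> topspace X"
    "\<forall>A m. openin X A \<and> z \<in> A \<longrightarrow> (\<exists>n>m. P n \<inter> A \<noteq> {})"
proof (rule ccontr)
  assume neg: "\<not> thesis"
  note main = that
  have fin: "\<exists>A. openin X A \<and> z \<in> A \<and> finite {n. P n \<inter> A \<noteq> {}}" if z: "z \<in> topspace X" for z
  proof (rule ccontr)
    assume *: "\<not> ?thesis"
    have "\<forall>A m. openin X A \<and> z \<in> A \<longrightarrow> (\<exists>n>m. P n \<inter> A \<noteq> {})"
    proof (intro allI impI)
      fix A m assume "openin X A \<and> z \<in> A"
      then have "infinite {n. P n \<inter> A \<noteq> {}}" using * by auto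
      then show "\<exists>n>m. P n \<inter> A \<noteq> {}" unfolding infinite_nat_iff_unbounded by simp
    qed
    from main[OF z this] neg show False by contradiction
  qed
  have "locally_finite_in X (range P)"
    unfolding locally_finite_in_def
  proof (intro conjI ballI)
    show "\<Union>(range P) \<subseteq> topspace X" using P(1) openin_subset by blast
    fix z assume "z \<in> topspace X"
    then obtain A where A: "openin X A" "z \<in> A" "finite {n. P n \<inter> A \<noteq> {}}"
      using fin by blast
    have "{U \<in> range P. U \<inter> A \<noteq> {}} = P ` {n. P n \<inter> A \<noteq> {}}" by auto
    with A show "\<exists>V. openin X V \<and> z \<in> V \<and> finite {U \<in> range P. U \<inter> V \<noteq> {}}"
      by (intro exI[of _ A]) simp
  qed
  then have "finite (range P)"
    using pc P unfolding pseudocompact_space_def by auto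
  then obtain n where n: "infinite {k. P k = P n}"
    using pigeonhole_infinite[of "UNIV :: nat set" P] by auto
  obtain z where z: "z \<in> P n" using P(2) by blast
  then have "z \<in> topspace X" using P(1) openin_subset by blast
  then obtain A where A: "z \<in> A" "finite {n. P n \<inter> A \<noteq> {}}"
    using fin by blast
  have "{k. P k = P n} \<subseteq> {n. P n \<inter> A \<noteq> {}}" using z A(1) by blast
  with A(2) n show False using finite_subset by blast
qed

text \<open>Open families pull back; surjectivity keeps the preimages non-empty and distinct. This
  serves for two retractions: onto a maximal subgroup with zero and onto a Brandt summand.\<close>

lemma pseudocompact_space_continuous_image:
  assumes pc: "pseudocompact_space X" and f: "continuous_map X Y f"
    and surj: "f ` topspace X = topspace Y"
  shows "pseudocompact_space Y"
  unfolding pseudocompact_space_def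
proof (intro allI impI)
  fix \<U> assume U: "(\<forall>U\<in>\<U>. openin Y U \<and> U \<noteq> {}) \<and> locally_finite_in Y \<U>"
  define p where "p U = {x \<in> topspace X. f x \<in> U}" for U
  have img: "f ` p U = U" if "U \<in> \<U>" for U
  proof -
    have "openin Y U" using U that by simp
    then have "U \<subseteq> f ` topspace X" using surj openin_subset by simp
    then show ?thesis unfolding p_def by auto
  qed
  have inj: "inj_on p \<U>" by (rule inj_on_inverseI[of _ "(`) f"]) (rule img)
  have "finite (p ` \<U>)"
  proof (rule pc[unfolded pseudocompact_space_def, rule_format], intro conjI ballI)
    fix V assume "V \<in> p ` \<U>"
    then obtain W where W: "W \<in> \<U>" "V = p W" by blast
    show "openin X V" using W U f by (auto simp: p_def intro: openin_continuous_map_preimage)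
    show "V \<noteq> {}" using img[OF W(1)] W U by auto
  next
    show "locally_finite_in X (p ` \<U>)"
      unfolding locally_finite_in_def
    proof (intro conjI ballI)
      show "\<Union>(p ` \<U>) \<subseteq> topspace X" by (auto simp: p_def)
      fix x assume x: "x \<in> topspace X"
      then have "f x \<in> topspace Y" using surj by blast
      then obtain V where V: "openin Y V" "f x \<in> V" "finite {U \<in> \<U>. U \<inter> V \<noteq> {}}"
        using U unfolding locally_finite_in_def by meson
      have "{W \<in> p ` \<U>. W \<inter> p V \<noteq> {}} \<subseteq> p ` {U \<in> \<U>. U \<inter> V \<noteq> {}}"
        by (auto simp: p_def)
      then have "finite {W \<in> p ` \<U>. W \<inter> p V \<noteq> {}}"
        using V(3) by (meson finite_imageI finite_subset)
      moreover have "openin X (p V)" unfolding p_def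
        using f V(1) by (rule openin_continuous_map_preimage)
      moreover have "x \<in> p V" using x V by (simp add: p_def)
      ultimately show "\<exists>V. openin X V \<and> x \<in> V \<and> finite {W \<in> p ` \<U>. W \<inter> V \<noteq> {}}" by blast
    qed
  qed
  then show "finite \<U>" using inj finite_imageD by blast
qed

text \<open>Local finiteness passes to the whole space: at a point outside \<open>C\<close> the
  complement of \<open>C\<close> meets no member of the family.\<close>

lemma pseudocompact_space_clopen_subtopology:
  assumes pc: "pseudocompact_space X" and "openin X C" and "closedin X C"
  shows "pseudocompact_space (subtopology X C)"
  unfolding pseudocompact_space_def
proof (intro allI impI)
  fix \<U> assume U: "(\<forall>U\<in>\<U>. openin (subtopology X C) U \<and> U \<noteq> {})
    \<and> locally_finite_in (subtopology X C) \<U>"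
  have op: "openin X U \<and> U \<subseteq> C" if "U \<in> \<U>" for U
    using U that assms(2) openin_open_subtopology by blast
  have "locally_finite_in X \<U>"
    unfolding locally_finite_in_def
  proof (intro conjI ballI)
    show "\<Union>\<U> \<subseteq> topspace X" using op openin_subset by blast
    fix x assume x: "x \<in> topspace X"
    show "\<exists>V. openin X V \<and> x \<in> V \<and> finite {U \<in> \<U>. U \<inter> V \<noteq> {}}"
    proof (cases "x \<in> C")
      case True
      then have "x \<in> topspace (subtopology X C)" using x by simp
      then obtain V where V: "openin (subtopology X C) V" "x \<in> V" "finite {U \<in> \<U>. U \<inter> V \<noteq> {}}"
        using U unfolding locally_finite_in_def by meson
      then show ?thesis using assms(2) openin_open_subtopology by blast
    next
      case False
      have "{U \<in> \<U>. U \<inter> (topspace X - C) \<noteq> {}} = {}" using op by blast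
      then have "finite {U \<in> \<U>. U \<inter> (topspace X - C) \<noteq> {}}" by (simp only: finite.emptyI)
      moreover have "openin X (topspace X - C)" using assms(3) by blast
      ultimately show ?thesis using x False by (intro exI[of _ "topspace X - C"]) simp
    qed
  qed
  then show "finite \<U>" using pc U op unfolding pseudocompact_space_def by auto
qed

lemma jointly_continuous_rectangle:
  assumes "continuous_map (prod_topology X X) X (\<lambda>(x, y). f x y)"
    and "openin X N" "p \<in> topspace X" "q \<in> topspace X" "f p q \<in> N"
  obtains A B where "openin X A" "openin X B" "p \<in> A" "q \<in> B" "\<forall>a\<in>A. \<forall>b\<in>B. f a b \<in> N"
proof -
  define M where "M = {r \<in> topspace (prod_topology X X). (case r of (x, y) \<Rightarrow> f x y) \<in> N}"
  have "openin (prod_topology X X) M"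
    unfolding M_def using assms(1,2) by (rule openin_continuous_map_preimage)
  moreover have "(p, q) \<in> M" unfolding M_def using assms by simp
  ultimately have "\<exists>A B. openin X A \<and> openin X B \<and> p \<in> A \<and> q \<in> B \<and> A \<times> B \<subseteq> M"
    by (simp add: openin_prod_topology_alt)
  then obtain A B where AB: "openin X A" "openin X B" "p \<in> A" "q \<in> B" "A \<times> B \<subseteq> M"
    by (elim exE conjE)
  have "\<forall>a\<in>A. \<forall>b\<in>B. f a b \<in> N"
  proof (intro ballI)
    fix a b assume "a \<in> A" "b \<in> B"
    then have "(a, b) \<in> M" using AB(5) by auto
    then show "f a b \<in> N" by (simp add: M_def)
  qed
  then show thesis by (rule that[OF AB(1-4)])
qed

section \<open>Semitopological groups\<close>

locale semitop_group = group K for K (structure) +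
  fixes X
  assumes space_eq: "topspace X = carrier K"
    and cont_l: "a \<in> carrier K \<Longrightarrow> continuous_map X X (\<lambda>x. a \<otimes> x)"
    and cont_r: "a \<in> carrier K \<Longrightarrow> continuous_map X X (\<lambda>x. x \<otimes> a)"
begin

section \<open>Translates of open sets and of closures\<close>

lemma open_carrier: "openin X U \<Longrightarrow> x \<in> U \<Longrightarrow> x \<in> carrier K"
  using openin_subset space_eq by blast

lemma open_preimage_l:
  "openin X U \<Longrightarrow> a \<in> carrier K \<Longrightarrow> openin X {x \<in> carrier K. a \<otimes> x \<in> U}"
  using openin_continuous_map_preimage[OF cont_l] space_eq by simp

lemma open_preimage_r:
  "openin X U \<Longrightarrow> a \<in> carrier K \<Longrightarrow> openin X {x \<in> carrier K. x \<otimes> a \<in> U}"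
  using openin_continuous_map_preimage[OF cont_r] space_eq by simp

text \<open>A translate is the preimage under translation by the inverse, so separate continuity
  makes it open.\<close>

lemma open_translate_l:
  assumes "openin X U" "a \<in> carrier K"
  shows "openin X ((\<lambda>x. a \<otimes> x) ` U)"
proof -
  have "(\<lambda>x. a \<otimes> x) ` U = {x \<in> carrier K. inv a \<otimes> x \<in> U}" (is "?L = ?R")
  proof
    show "?L \<subseteq> ?R" using assms open_carrier by (auto simp flip: m_assoc)
    have "x = a \<otimes> (inv a \<otimes> x)" if "x \<in> carrier K" for x
      using assms that by (simp flip: m_assoc)
    then show "?R \<subseteq> ?L" by blast
  qed
  then show ?thesis using open_preimage_l assms by simp
qed

lemma open_translate_r:
  assumes "openin X U" "a \<in> carrier K"
  shows "openin X ((\<lambda>x. x \<otimes> a) ` U)"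
proof -
  have "(\<lambda>x. x \<otimes> a) ` U = {x \<in> carrier K. x \<otimes> inv a \<in> U}" (is "?L = ?R")
  proof
    show "?L \<subseteq> ?R" using assms open_carrier by (auto simp: m_assoc)
    have "x = (x \<otimes> inv a) \<otimes> a" if "x \<in> carrier K" for x
      using assms that by (simp add: m_assoc)
    then show "?R \<subseteq> ?L" by blast
  qed
  then show ?thesis using open_preimage_r assms by simp
qed

lemma closure_translate_l:
  assumes "p \<in> X closure_of A" "a \<in> carrier K" "\<And>x. x \<in> A \<Longrightarrow> a \<otimes> x \<in> B"
  shows "a \<otimes> p \<in> X closure_of B"
  using continuous_map_image_closure_subset[OF cont_l[OF assms(2)], of A] assms(1,3)
    closure_of_mono[of "(\<lambda>x. a \<otimes> x) ` A" B X] by blast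

lemma closure_translate_r:
  assumes "p \<in> X closure_of A" "a \<in> carrier K" "\<And>x. x \<in> A \<Longrightarrow> x \<otimes> a \<in> B"
  shows "p \<otimes> a \<in> X closure_of B"
  using continuous_map_image_closure_subset[OF cont_r[OF assms(2)], of A] assms(1,3)
    closure_of_mono[of "(\<lambda>x. x \<otimes> a) ` A" B X] by blast

text \<open>Two overlaps near \<open>z\<close>, taken one after the other, replace joint continuity.
  Consequently \<open>inv (x n) \<otimes> x k\<close> times two elements of \<open>U\<close> lies in
  \<open>U\<close>, which the isolation criteria refute for a sequence tending fast to zero.\<close>

lemma accumulating_translates:
  fixes x :: "nat \<Rightarrow> 'a"
  assumes x: "\<And>n. x n \<in> carrier K" and U: "openin X U" "\<one> \<in> U" and z: "z \<in> carrier K"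
    and acc: "\<forall>A m. openin X A \<and> z \<in> A \<longrightarrow> (\<exists>n>m. (\<lambda>u. x n \<otimes> u) ` U \<inter> A \<noteq> {})"
  obtains n k u v w where "n < k" "u \<in> U" "v \<in> U" "w \<in> U" "x k \<otimes> u \<otimes> v = x n \<otimes> w"
proof -
  have "z \<in> (\<lambda>u. z \<otimes> u) ` U" using U z by (metis image_eqI r_one)
  then obtain n where "(\<lambda>u. x n \<otimes> u) ` U \<inter> (\<lambda>u. z \<otimes> u) ` U \<noteq> {}"
    using acc open_translate_l[OF U(1) z] by blast
  then obtain s where "s \<in> (\<lambda>u. x n \<otimes> u) ` U" "s \<in> (\<lambda>u. z \<otimes> u) ` U"
    by blast
  then obtain v w where "v \<in> U" "w \<in> U" "s = x n \<otimes> w" "s = z \<otimes> v"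
    by (elim imageE)
  then have n: "v \<in> U" "w \<in> U" "x n \<otimes> w = z \<otimes> v" by simp_all
  \<comment> \<open>With \<open>n\<close> and \<open>v\<close> fixed, right translation by
    \<open>v\<close> pulls the set \<open>x n U\<close> back to a neighbourhood of \<open>z\<close>,
    which a later translate meets.\<close>
  let ?A = "{y \<in> carrier K. y \<otimes> v \<in> (\<lambda>u. x n \<otimes> u) ` U}"
  have "openin X ?A"
    using open_preimage_r[OF open_translate_l[OF U(1) x] open_carrier[OF U(1) n(1)]] .
  moreover have "z \<in> ?A" using n(2) z by (simp add: n(3)[symmetric] imageI)
  ultimately obtain k where "n < k" "(\<lambda>u. x k \<otimes> u) ` U \<inter> ?A \<noteq> {}"
    using acc by blast
  then obtain u w' where "n < k" "u \<in> U" "w' \<in> U" "x k \<otimes> u \<otimes> v = x n \<otimes> w'"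
    by blast
  then show thesis using that n(1) by metis
qed

lemma joint_continuity:
  assumes joint: "continuous_map (prod_topology X X) X (\<lambda>(x, y). x \<otimes> y)"
    and U: "openin X U" "\<one> \<in> U"
  obtains W where "openin X W" "\<one> \<in> W" "W \<subseteq> U" "\<forall>a\<in>W. \<forall>b\<in>W. a \<otimes> b \<in> U"
proof -
  have one: "\<one> \<in> topspace X" "\<one> \<otimes> \<one> \<in> U" using space_eq U by auto
  obtain A B where AB: "openin X A" "openin X B" "\<one> \<in> A" "\<one> \<in> B" "\<forall>a\<in>A. \<forall>b\<in>B. a \<otimes> b \<in> U"
    by (rule jointly_continuous_rectangle[OF joint U(1) one(1) one(1) one(2)])
  show thesis
  proof (rule that[of "A \<inter> B \<inter> U"])
    show "openin X (A \<inter> B \<inter> U)" using AB(1,2) U(1) by (intro openin_Int)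
  qed (use AB U in auto)
qed

text \<open>If the conclusion fails, one finds \<open>x\<^sub>n\<close> near the unit with inverses outside the closure of
  \<open>U\<close>. Tails of the partial products \<open>a\<^sub>n = x\<^sub>0\<cdots>x\<^sub>n\<^sub>-\<^sub>1\<close> stay small, so any accumulation
  point \<open>y\<close> of small neighbourhoods of the \<open>a\<^sub>n\<close> forces \<open>x\<^sub>n\<^sup>-\<^sup>1 = a\<^sub>n\<^sub>+\<^sub>1\<^sup>-\<^sup>1 y y\<^sup>-\<^sup>1 a\<^sub>n\<close>
  to be almost in the closure of \<open>U\<close>.\<close>

lemma pseudocompact_inverse_near_one:
  assumes pc: "pseudocompact_space X"
    and joint: "continuous_map (prod_topology X X) X (\<lambda>(x, y). x \<otimes> y)"
    and U: "openin X U" "\<one> \<in> U"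
  obtains V where "openin X V" "\<one> \<in> V" "\<forall>x\<in>V. inv x \<in> X closure_of U"
proof (rule ccontr)
  assume neg: "\<not> thesis"
  have "\<forall>V. \<exists>x. openin X V \<and> \<one> \<in> V \<longrightarrow> x \<in> V \<and> inv x \<notin> X closure_of U"
    using neg that by blast
  then obtain c where c: "\<And>V. openin X V \<Longrightarrow> \<one> \<in> V \<Longrightarrow> c V \<in> V \<and> inv (c V) \<notin> X closure_of U"
    by metis
  obtain W where W: "openin X W" "\<one> \<in> W" "W \<subseteq> U" "\<forall>a\<in>W. \<forall>b\<in>W. a \<otimes> b \<in> U"
    by (rule joint_continuity[OF joint U])
  \<comment> \<open>Each step shrinks \<open>V n\<close> so that \<open>x n\<close> times
    \<open>V (n+1)\<close> stays in \<open>V n\<close>. As \<open>x n\<close> is a function of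
    \<open>V n\<close>, the recursion carries only the sets.\<close>
  define V where "V = rec_nat W (\<lambda>_ V. V \<inter> {v \<in> carrier K. c V \<otimes> v \<in> V})"
  define x where "x n = c (V n)" for n
  define a where "a = rec_nat \<one> (\<lambda>n a. a \<otimes> x n)"
  \<comment> \<open>Since \<open>inv (x n)\<close> lies outside the closure of \<open>U\<close>, so
    does \<open>inv (x n) \<otimes> d\<close> for \<open>d\<close> near the unit.\<close>
  define D where "D n = V n \<inter> {d \<in> carrier K. inv (x n) \<otimes> d \<in> topspace X - X closure_of U}" for n
  have V0: "V 0 = W" and VS: "V (Suc n) = V n \<inter> {v \<in> carrier K. x n \<otimes> v \<in> V n}" for n
    by (simp_all add: V_def x_def)
  have a0: "a 0 = \<one>" and aS: "a (Suc n) = a n \<otimes> x n" for n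
    by (simp_all add: a_def)
  have V: "openin X (V n) \<and> \<one> \<in> V n" for n
  proof (induction n)
    case 0 then show ?case using W V0 by simp
  next
    case (Suc n)
    then have "x n \<in> V n" using c by (simp add: x_def)
    moreover from this have "x n \<in> carrier K" using Suc open_carrier by blast
    ultimately show ?case using Suc open_preimage_l by (auto simp: VS)
  qed
  have xV: "x n \<in> V n" and xU: "inv (x n) \<notin> X closure_of U" for n
    using c V by (auto simp: x_def)
  have xc [simp]: "x n \<in> carrier K" for n using xV V open_carrier by blast
  have ac [simp]: "a n \<in> carrier K" for n by (induction n) (simp_all add: a0 aS)
  have VW: "V n \<subseteq> W" for n by (induction n) (auto simp: V0 VS)
  have "openin X (topspace X - X closure_of U)"
    by (simp add: openin_diff)
  then have D: "openin X (D n)" "\<one> \<in> D n" for n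
    unfolding D_def using V xU open_preimage_l xc by (blast, simp add: space_eq)
  \<comment> \<open>Telescoping: \<open>a m\<close> is \<open>a n\<close> times \<open>x n\<close>,
    ..., \<open>x (m - 1)\<close>, and these factors, applied from the last one inwards, take
    \<open>V (j+1)\<close> into \<open>V j\<close>.\<close>
  have tail: "inv (a n) \<otimes> (a m \<otimes> v) \<in> V n" if "n \<le> m" "v \<in> V m" for n m v
    using that
  proof (induction arbitrary: v rule: dec_induct)
    case base
    then show ?case using V open_carrier by (metis ac inv_closed l_inv l_one m_assoc)
  next
    case (step m)
    then have "x m \<otimes> v \<in> V m" "v \<in> carrier K" by (auto simp: VS)
    then show ?case using step.IH[of "x m \<otimes> v"] by (simp add: aS m_assoc)
  qed
  let ?O = "\<lambda>n. (\<lambda>d. a n \<otimes> d) ` D n"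
  have O: "openin X (?O n)" "?O n \<noteq> {}" for n
    using D open_translate_l by (simp, blast)
  obtain y where y: "y \<in> topspace X"
    and acc: "\<forall>A m. openin X A \<and> y \<in> A \<longrightarrow> (\<exists>n>m. ?O n \<inter> A \<noteq> {})"
    by (rule pseudocompact_accumulation[OF pc O])
  have yc: "y \<in> carrier K" using y space_eq by simp
  \<comment> \<open>By \<open>tail\<close>, \<open>inv (a n)\<close> moves all later sets
    \<open>D\<close>, translated by their \<open>a m\<close>, into \<open>W\<close>, hence their
    accumulation point \<open>y\<close> into the closure of \<open>W\<close>.\<close>
  have cl: "inv (a n) \<otimes> y \<in> X closure_of W" for n
    unfolding in_closure_of
  proof (intro conjI allI impI)
    show "inv (a n) \<otimes> y \<in> topspace X" using yc space_eq by simp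
    fix A assume A: "inv (a n) \<otimes> y \<in> A \<and> openin X A"
    then have "\<exists>m>n. ?O m \<inter> {s \<in> carrier K. inv (a n) \<otimes> s \<in> A} \<noteq> {}"
      by (intro acc[rule_format] conjI open_preimage_l) (auto simp: yc)
    then obtain m where "n < m" "?O m \<inter> {s \<in> carrier K. inv (a n) \<otimes> s \<in> A} \<noteq> {}"
      by blast
    then obtain d where "d \<in> V m" "inv (a n) \<otimes> (a m \<otimes> d) \<in> A"
      unfolding D_def by blast
    then show "\<exists>s. s \<in> W \<and> s \<in> A" using tail[of n m d] VW \<open>n < m\<close> by auto
  qed
  have "y \<in> (\<lambda>u. y \<otimes> u) ` W" using W yc by (metis image_eqI r_one)
  then obtain n where "?O n \<inter> (\<lambda>u. y \<otimes> u) ` W \<noteq> {}"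
    using acc open_translate_l[OF W(1) yc] by blast
  then obtain s where "s \<in> ?O n" "s \<in> (\<lambda>u. y \<otimes> u) ` W"
    by blast
  then obtain d w where "d \<in> D n" "w \<in> W" "s = a n \<otimes> d" "s = y \<otimes> w"
    by (elim imageE)
  then have n: "d \<in> D n" "w \<in> W" "a n \<otimes> d = y \<otimes> w" by simp_all
  have wc: "w \<in> carrier K" and dc: "d \<in> carrier K" using n W D open_carrier by blast+
  \<comment> \<open>One element, two readings: as \<open>inv (a (n+1)) \<otimes> y\<close> times
    \<open>w\<close> it lies in the closure of \<open>U\<close>, because \<open>W W\<close> is in
    \<open>U\<close>; as \<open>inv (x n) \<otimes> d\<close> it lies outside by the definition of
    \<open>D n\<close>.\<close>
  have "inv (a (Suc n)) \<otimes> y \<otimes> w = inv (a (Suc n)) \<otimes> (a n \<otimes> d)"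
    using n wc yc by (simp add: m_assoc)
  also have "\<dots> = inv (x n) \<otimes> (inv (a n) \<otimes> (a n \<otimes> d))"
    using dc by (simp add: aS inv_mult_group m_assoc)
  also have "\<dots> = inv (x n) \<otimes> d" using dc by (simp flip: m_assoc)
  finally have "inv (x n) \<otimes> d \<in> X closure_of U"
    using closure_translate_r[OF cl[of "Suc n"] wc, of U] W(4) n(2) by metis
  then show False using n(1) by (auto simp: D_def)
qed

end

section \<open>Semitopological groups with adjoined zero\<close>

text \<open>The case in mind is a maximal subgroup with the zero of the semigroup adjoined. The
  product of \<open>K\<close> is a total function, so it also covers products with \<open>z\<close>,
  which is outside the carrier.\<close>

locale group_with_zero_space = group K for K (structure) +
  fixes X and z
  assumes hausdorff: "Hausdorff_space X"
    and space_eq0: "topspace X = insert z (carrier K)"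
    and zero_notin: "z \<notin> carrier K"
    and zero_l: "x \<in> topspace X \<Longrightarrow> z \<otimes> x = z"
    and zero_r: "x \<in> topspace X \<Longrightarrow> x \<otimes> z = z"
    and cont_l0: "a \<in> carrier K \<Longrightarrow> continuous_map X X (\<lambda>x. a \<otimes> x)"
    and cont_r0: "a \<in> carrier K \<Longrightarrow> continuous_map X X (\<lambda>x. x \<otimes> a)"
begin

lemma open_group: "openin X (carrier K)"
proof -
  have "closedin X {z}"
    using hausdorff space_eq0 by (simp add: closedin_Hausdorff_singleton)
  then have "openin X (topspace X - {z})" by blast
  moreover have "topspace X - {z} = carrier K" using space_eq0 zero_notin by auto
  ultimately show ?thesis by simp
qed

abbreviation "Y \<equiv> subtopology X (carrier K)"

sublocale semitop_group K Y
proof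
  show "topspace Y = carrier K" using space_eq0 by auto
  show "continuous_map Y Y (\<lambda>x. a \<otimes> x)" "continuous_map Y Y (\<lambda>x. x \<otimes> a)"
    if "a \<in> carrier K" for a
    using that cont_l0[OF that] cont_r0[OF that]
    by (auto simp: continuous_map_in_subtopology continuous_map_from_subtopology)
qed

lemma open_Y: "openin Y U \<longleftrightarrow> openin X U \<and> U \<subseteq> carrier K"
  by (simp add: open_group openin_open_subtopology)

section \<open>Group elements near zero\<close>

lemma separate:
  obtains U V where "openin X V" "z \<in> V" "openin Y U" "\<one> \<in> U" "U \<inter> V = {}"
proof -
  have "z \<noteq> \<one>" using zero_notin by auto
  then obtain U V where UV: "openin X U" "openin X V" "\<one> \<in> U" "z \<in> V" "U \<inter> V = {}"
    using hausdorff[unfolded Hausdorff_space_def] space_eq0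
    by (metis disjnt_def insertCI one_closed)
  have "openin Y (U \<inter> carrier K)" using UV open_group open_Y by blast
  then show thesis using that[of V "U \<inter> carrier K"] UV by blast
qed

text \<open>All translations fix \<open>z\<close>, so on one neighbourhood of \<open>z\<close>
  finitely many of them stay inside \<open>V\<close>; it contains a group element because
  \<open>z\<close> is not isolated.\<close>

lemma exists_near_zero:
  assumes "\<not> openin X {z}" "openin X V" "z \<in> V" "finite F" "F \<subseteq> carrier K"
  shows "\<exists>x \<in> carrier K. x \<in> V \<and> (\<forall>f\<in>F. inv f \<otimes> x \<in> V)"
proof -
  \<comment> \<open>The inner \<open>topspace X\<close> is for empty \<open>F\<close>, where the
    intersection is the whole type.\<close>
  let ?W = "V \<inter> (topspace X \<inter> (\<Inter>f\<in>F. {x \<in> topspace X. inv f \<otimes> x \<in> V}))"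
  have "openin X (topspace X \<inter> (\<Inter>f\<in>F. {x \<in> topspace X. inv f \<otimes> x \<in> V}))"
  proof (intro openin_Int_Inter)
    fix A assume "A \<in> (\<lambda>f. {x \<in> topspace X. inv f \<otimes> x \<in> V}) ` F"
    then show "openin X A" using assms(2,5)
      by (auto intro!: openin_continuous_map_preimage[OF cont_l0])
  qed (use assms in auto)
  then have "openin X ?W" using assms(2) by blast
  moreover have "z \<in> ?W" using assms zero_r space_eq0 by auto
  ultimately have "?W \<noteq> {z}" using assms(1) by metis
  then obtain x where "x \<in> ?W" "x \<noteq> z" using \<open>z \<in> ?W\<close> by blast
  then show ?thesis using space_eq0 by auto
qed

lemma sequence_to_zero:
  assumes "\<not> openin X {z}" "openin X V" "z \<in> V"
  obtains x :: "nat \<Rightarrow> 'a" where "\<forall>n. x n \<in> carrier K" "\<forall>n. x n \<in> V"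
    "\<forall>n. \<forall>k>n. inv (x n) \<otimes> x k \<in> V"
proof -
  have "\<forall>F. \<exists>x. finite F \<and> F \<subseteq> carrier K \<longrightarrow> x \<in> carrier K \<and> x \<in> V \<and> (\<forall>f\<in>F. inv f \<otimes> x \<in> V)"
    using exists_near_zero[OF assms] by blast
  then obtain c where c: "\<And>F. finite F \<Longrightarrow> F \<subseteq> carrier K \<Longrightarrow>
      c F \<in> carrier K \<and> c F \<in> V \<and> (\<forall>f\<in>F. inv f \<otimes> c F \<in> V)"
    by metis
  \<comment> \<open>\<open>F n\<close> collects the first \<open>n\<close> points, and
    \<open>c (F n)\<close> is the next one, so each point is chosen with regard to all earlier
    ones.\<close>
  define F where "F = rec_nat {} (\<lambda>_ F. insert (c F) F)"
  have F0: "F 0 = {}" and FS: "F (Suc n) = insert (c (F n)) (F n)" for n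
    by (simp_all add: F_def)
  have F: "finite (F n) \<and> F n \<subseteq> carrier K" for n
    by (induction n) (use c in \<open>auto simp: F0 FS\<close>)
  have mem: "c (F n) \<in> F k" if "n < k" for n k
    using that by (induction k) (auto simp: FS less_Suc_eq)
  have cF: "c (F n) \<in> carrier K \<and> c (F n) \<in> V \<and> (\<forall>f\<in>F n. inv f \<otimes> c (F n) \<in> V)" for n
    using c[of "F n"] F[of n] by simp
  show thesis
    by (rule that[of "\<lambda>n. c (F n)"]) (simp_all add: cF mem)
qed

section \<open>Criteria for zero to be isolated\<close>

lemma isolated_if_finite_cover:
  assumes "openin X V" "z \<in> V" "C \<inter> V = {}" "C \<subseteq> carrier K"
    and "finite F" "F \<subseteq> carrier K" and cover: "carrier K \<subseteq> setmult (\<otimes>) F C"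
  shows "openin X {z}"
proof (rule ccontr)
  assume "\<not> openin X {z}"
  \<comment> \<open>A point whose translates by all \<open>inv f\<close> are near zero cannot lie in
    any \<open>f C\<close>, since \<open>C\<close> avoids \<open>V\<close>.\<close>
  then obtain x where x: "x \<in> carrier K" "\<forall>f\<in>F. inv f \<otimes> x \<in> V"
    using exists_near_zero assms by meson
  then obtain f u where f: "f \<in> F" "u \<in> C" "x = f \<otimes> u"
    using cover unfolding setmult_def by blast
  then have "inv f \<otimes> x = u" using assms by (auto simp: subset_iff simp flip: m_assoc)
  then show False using x f assms by blast
qed

lemma isolated_if_left_precompact:
  assumes "left_precompact X (carrier K) (\<otimes>) \<one>"
  shows "openin X {z}"
proof -
  obtain U V where UV: "openin X V" "z \<in> V" "openin Y U" "\<one> \<in> U" "U \<inter> V = {}"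
    by (rule separate)
  then obtain F where "finite F" "F \<subseteq> carrier K" "setmult (\<otimes>) F U = carrier K"
    using assms unfolding left_precompact_def by meson
  then show ?thesis using isolated_if_finite_cover[of V U F] UV open_Y by blast
qed

text \<open>\<open>accumulating_translates\<close> yields \<open>inv (x n) \<otimes> x k\<close> as
  \<open>w\<close> times \<open>inv (u \<otimes> v)\<close>. Inversion being almost continuous at
  the unit, this lies in the closure of \<open>U\<close>, yet the sequence keeps it in
  \<open>V\<close>, an open set disjoint from \<open>U\<close>.\<close>

lemma isolated_if_paratopological:
  assumes pc: "pseudocompact_space Y"
    and joint: "continuous_map (prod_topology Y Y) Y (\<lambda>(x, y). x \<otimes> y)"
  shows "openin X {z}"
proof (rule ccontr)
  assume iso: "\<not> openin X {z}"
  obtain U V where UV: "openin X V" "z \<in> V" "openin Y U" "\<one> \<in> U" "U \<inter> V = {}"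
    by (rule separate)
  obtain W where W: "openin Y W" "\<one> \<in> W" "W \<subseteq> U" "\<forall>a\<in>W. \<forall>b\<in>W. a \<otimes> b \<in> U"
    by (rule joint_continuity[OF joint UV(3,4)])
  obtain V' where V': "openin Y V'" "\<one> \<in> V'" "\<forall>x\<in>V'. inv x \<in> Y closure_of W"
    by (rule pseudocompact_inverse_near_one[OF pc joint W(1,2)])
  have VW: "openin Y (V' \<inter> W)" "\<one> \<in> V' \<inter> W" using V' W by auto
  obtain N where N: "openin Y N" "\<one> \<in> N" "N \<subseteq> V' \<inter> W"
      "\<forall>a\<in>N. \<forall>b\<in>N. a \<otimes> b \<in> V' \<inter> W"
    by (rule joint_continuity[OF joint VW])
  obtain x :: "nat \<Rightarrow> 'a" where x: "\<forall>n. x n \<in> carrier K" "\<forall>n. x n \<in> V" "\<forall>n. \<forall>k>n. inv (x n) \<otimes> x k \<in> V"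
    by (rule sequence_to_zero[OF iso UV(1,2)])
  have O: "openin Y ((\<lambda>u. x n \<otimes> u) ` N)" "(\<lambda>u. x n \<otimes> u) ` N \<noteq> {}" for n
    using N open_translate_l x by auto
  \<comment> \<open>Here the group itself is pseudocompact, so the accumulation point is a group
    element and not zero.\<close>
  obtain y where y: "y \<in> topspace Y"
    "\<forall>A m. openin Y A \<and> y \<in> A \<longrightarrow> (\<exists>n>m. (\<lambda>u. x n \<otimes> u) ` N \<inter> A \<noteq> {})"
    by (rule pseudocompact_accumulation[OF pc O])
  have yc: "y \<in> carrier K" using y(1) by simp
  obtain n k u v w where h: "n < k" "u \<in> N" "v \<in> N" "w \<in> N" "x k \<otimes> u \<otimes> v = x n \<otimes> w"
    by (rule accumulating_translates[OF x(1)[rule_format] N(1,2) yc y(2)])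
  have car: "u \<in> carrier K" "v \<in> carrier K" "w \<in> carrier K" using h N open_carrier by blast+
  have "inv (x n) \<otimes> x k \<otimes> (u \<otimes> v) = inv (x n) \<otimes> (x k \<otimes> u \<otimes> v)"
    using car x by (simp add: m_assoc)
  also have "\<dots> = w" unfolding h(5) using car x by (simp flip: m_assoc)
  finally have "inv (x n) \<otimes> x k = w \<otimes> inv (u \<otimes> v)"
    using car x by (metis inv_closed inv_solve_right m_closed)
  moreover have "w \<otimes> inv (u \<otimes> v) \<in> Y closure_of U"
  proof (rule closure_translate_l[where A = W])
    show "inv (u \<otimes> v) \<in> Y closure_of W" using V' N h by blast
  qed (use car W N h in auto)
  ultimately have "inv (x n) \<otimes> x k \<in> Y closure_of U" by simp
  moreover have "inv (x n) \<otimes> x k \<in> V \<inter> carrier K" using x h(1) by auto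
  moreover have "openin Y (V \<inter> carrier K)" using UV(1) open_group open_Y by blast
  ultimately obtain s where "s \<in> U" "s \<in> V \<inter> carrier K" unfolding in_closure_of by meson
  then show False using UV(5) by auto
qed

text \<open>Near zero only finitely many conditions can be met at a time; an accumulation point of
  the sets \<open>P n\<close> replaces a point meeting all of them. It lies in some
  \<open>f k U\<close>, which then meets a \<open>P n\<close> with \<open>n > k\<close>, so
  \<open>U\<close> meets \<open>V\<close>.\<close>

lemma isolated_if_left_omega_precompact:
  assumes pc: "pseudocompact_space Y"
    and omega: "left_omega_precompact X (carrier K) (\<otimes>) \<one>"
  shows "openin X {z}"
proof (rule ccontr)
  assume iso: "\<not> openin X {z}"
  obtain U V where UV: "openin X V" "z \<in> V" "openin Y U" "\<one> \<in> U" "U \<inter> V = {}"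
    by (rule separate)
  obtain F where F: "countable F" "F \<subseteq> carrier K" "setmult (\<otimes>) F U = carrier K"
    using omega UV unfolding left_omega_precompact_def by meson
  have "F \<noteq> {}" using F(3) by (auto simp: setmult_def)
  \<comment> \<open>The enumeration may repeat elements, so finite \<open>F\<close> is covered
    too.\<close>
  define f where "f = from_nat_into F"
  have f: "range f = F" using F \<open>F \<noteq> {}\<close> by (simp add: f_def range_from_nat_into)
  have fc: "f n \<in> carrier K" for n using f F by blast
  have VY: "openin Y (V \<inter> carrier K)" using UV open_group open_Y by blast
  define P where "P n = carrier K \<inter> (\<Inter>k\<in>{..n}. {x \<in> carrier K. inv (f k) \<otimes> x \<in> V \<inter> carrier K})" for n
  have PO: "openin Y (P n)" for n
    unfolding P_def
  proof (intro openin_Int_Inter)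
    fix A assume "A \<in> (\<lambda>k. {x \<in> carrier K. inv (f k) \<otimes> x \<in> V \<inter> carrier K}) ` {..n}"
    then show "openin Y A" using open_preimage_l[OF VY] fc by auto
  qed (simp_all add: open_Y open_group)
  have PN: "P n \<noteq> {}" for n
    using exists_near_zero[OF iso UV(1,2), of "f ` {..n}"] fc by (fastforce simp: P_def)
  obtain y where y: "y \<in> topspace Y"
    "\<forall>A m. openin Y A \<and> y \<in> A \<longrightarrow> (\<exists>n>m. P n \<inter> A \<noteq> {})"
    by (rule pseudocompact_accumulation[OF pc PO PN])
  then have "y \<in> setmult (\<otimes>) F U" using F by simp
  then obtain g u where "g \<in> F" and u: "u \<in> U" "y = g \<otimes> u"
    unfolding setmult_def by blast
  then obtain k where "g = f k" using f by blast
  then have "y \<in> (\<lambda>u. f k \<otimes> u) ` U" using u by blast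
  then obtain n where n: "k < n" "P n \<inter> (\<lambda>u. f k \<otimes> u) ` U \<noteq> {}"
    using y(2) open_translate_l[OF UV(3) fc] by blast
  then obtain v where v: "v \<in> U" "f k \<otimes> v \<in> P n" by blast
  then have "inv (f k) \<otimes> (f k \<otimes> v) \<in> V" using n by (auto simp: P_def)
  moreover have "v \<in> carrier K" using v UV open_carrier by blast
  ultimately have "v \<in> V" using fc by (simp flip: m_assoc)
  then show False using v(1) UV(5) by auto
qed

text \<open>Choose \<open>x\<^sub>n\<close> converging to zero fast. The sets \<open>x\<^sub>n U\<close> can accumulate only at zero, while
  the sets \<open>U x\<^sub>n\<^sup>-\<^sup>1\<close> accumulate at some group element \<open>y\<close>; continuity of the product at
  \<open>(y, 0)\<close> then brings elements of \<open>U U\<close> close to zero.\<close>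

lemma isolated_if_topological_semigroup:
  assumes pc: "pseudocompact_space X"
    and joint: "continuous_map (prod_topology X X) X (\<lambda>(x, y). x \<otimes> y)"
  shows "openin X {z}"
proof (rule ccontr)
  assume iso: "\<not> openin X {z}"
  have sp: "z \<in> topspace X" "\<one> \<in> topspace X" using space_eq0 by auto
  obtain U0 V0 where UV0: "openin X V0" "z \<in> V0" "openin Y U0" "\<one> \<in> U0" "U0 \<inter> V0 = {}"
    by (rule separate)
  have U0X: "openin X U0" using UV0 open_Y by blast
  have prods: "z \<otimes> \<one> \<in> V0" "z \<otimes> z \<in> V0" "\<one> \<otimes> \<one> \<in> U0"
    using zero_l[OF sp(1)] zero_l[OF sp(2)] UV0 by auto
  \<comment> \<open>The aim of these choices: products from \<open>V U U\<close> and from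
    \<open>V V\<close> lie in \<open>V0\<close>, those from \<open>U U\<close> in \<open>U0\<close>,
    which is disjoint from \<open>V0\<close>.\<close>
  obtain V1 U1 where 1: "openin X V1" "openin X U1" "z \<in> V1" "\<one> \<in> U1"
    "\<forall>a\<in>V1. \<forall>b\<in>U1. a \<otimes> b \<in> V0"
    by (rule jointly_continuous_rectangle[OF joint UV0(1) sp prods(1)])
  have prod1: "z \<otimes> \<one> \<in> V1" using zero_l[OF sp(2)] 1(3) by simp
  obtain V2 U2 where 2: "openin X V2" "openin X U2" "z \<in> V2" "\<one> \<in> U2"
    "\<forall>a\<in>V2. \<forall>b\<in>U2. a \<otimes> b \<in> V1"
    by (rule jointly_continuous_rectangle[OF joint 1(1) sp prod1])
  obtain V3 V4 where 3: "openin X V3" "openin X V4" "z \<in> V3" "z \<in> V4"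
    "\<forall>a\<in>V3. \<forall>b\<in>V4. a \<otimes> b \<in> V0"
    by (rule jointly_continuous_rectangle[OF joint UV0(1) sp(1) sp(1) prods(2)])
  obtain U3 U4 where 4: "openin X U3" "openin X U4" "\<one> \<in> U3" "\<one> \<in> U4"
    "\<forall>a\<in>U3. \<forall>b\<in>U4. a \<otimes> b \<in> U0"
    by (rule jointly_continuous_rectangle[OF joint U0X sp(2) sp(2) prods(3)])
  define V where "V = V0 \<inter> V1 \<inter> V2 \<inter> V3 \<inter> V4"
  define U where "U = U0 \<inter> U1 \<inter> U2 \<inter> U3 \<inter> U4"
  have V: "openin X V" "z \<in> V" unfolding V_def using UV0 1 2 3 by auto
  have UX: "openin X U" and U1: "\<one> \<in> U" unfolding U_def using U0X UV0 1 2 4 by auto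
  have Uc: "U \<subseteq> carrier K" using UV0(3) open_Y unfolding U_def by blast
  have UY: "openin Y U" using UX Uc open_Y by blast
  obtain x :: "nat \<Rightarrow> 'a" where x: "\<forall>n. x n \<in> carrier K" "\<forall>n. x n \<in> V" "\<forall>n. \<forall>k>n. inv (x n) \<otimes> x k \<in> V"
    by (rule sequence_to_zero[OF iso V])
  let ?P = "\<lambda>n. (\<lambda>u. u \<otimes> inv (x n)) ` U" and ?Q = "\<lambda>n. (\<lambda>u. x n \<otimes> u) ` U"
  have P: "openin X (?P n)" "?P n \<noteq> {}" for n
    using open_translate_r[OF UY, of "inv (x n)"] x U1 open_Y by auto
  have Q: "openin X (?Q n)" "?Q n \<noteq> {}" for n
    using open_translate_l[OF UY, of "x n"] x U1 open_Y by auto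
  obtain y where y: "y \<in> topspace X"
    "\<forall>A m. openin X A \<and> y \<in> A \<longrightarrow> (\<exists>n>m. ?P n \<inter> A \<noteq> {})"
    by (rule pseudocompact_accumulation[OF pc P])
  \<comment> \<open>Accumulation at zero would put some \<open>u \<otimes> inv (x n)\<close> in
    \<open>V\<close>; multiplied by \<open>x n\<close>, also in \<open>V\<close>, it gives
    \<open>u\<close> in \<open>V0\<close>.\<close>
  have "y \<noteq> z"
  proof
    assume "y = z"
    then obtain n where "?P n \<inter> V \<noteq> {}" using y(2) V by blast
    then obtain u where u: "u \<in> U" "u \<otimes> inv (x n) \<in> V" by blast
    then have "u \<otimes> inv (x n) \<otimes> x n \<in> V0" using 3(5) x(2) unfolding V_def by blast
    moreover have "u \<otimes> inv (x n) \<otimes> x n = u" using u Uc x by (auto simp: m_assoc subset_iff)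
    ultimately show False using u UV0 unfolding U_def by auto
  qed
  have yz: "y \<otimes> z \<in> V" using zero_r y V by simp
  obtain A B where AB: "openin X A" "openin X B" "y \<in> A" "z \<in> B"
    "\<forall>a\<in>A. \<forall>b\<in>B. a \<otimes> b \<in> V"
    by (rule jointly_continuous_rectangle[OF joint V(1) y(1) sp(1) yz])
  \<comment> \<open>Along the subsequence every \<open>?P (r n)\<close> meets \<open>A\<close>, so
    the index found later for \<open>?Q\<close> serves both families.\<close>
  have inf: "infinite {n. ?P n \<inter> A \<noteq> {}}"
    unfolding infinite_nat_iff_unbounded using y(2) AB(1,3) by simp
  obtain r :: "nat \<Rightarrow> nat" where r: "strict_mono r" "\<And>n. ?P (r n) \<inter> A \<noteq> {}"
    using infinite_enumerate[OF inf] by auto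
  obtain t where t: "t \<in> topspace X"
    "\<forall>A m. openin X A \<and> t \<in> A \<longrightarrow> (\<exists>n>m. ?Q (r n) \<inter> A \<noteq> {})"
    by (rule pseudocompact_accumulation[OF pc, of "\<lambda>n. ?Q (r n)"]) (use Q in auto)
  \<comment> \<open>At a group element \<open>accumulating_translates\<close> would make some
    \<open>w\<close> in \<open>U\<close> a product from \<open>V U U\<close>, which lies in
    \<open>V0\<close>.\<close>
  have "t = z"
  proof (rule ccontr)
    assume "t \<noteq> z"
    then have tc: "t \<in> carrier K" using t space_eq0 by auto
    have acc: "\<forall>A m. openin Y A \<and> t \<in> A \<longrightarrow> (\<exists>n>m. ?Q (r n) \<inter> A \<noteq> {})"
      using t(2) open_Y by simp
    obtain n k u v w where h: "n < k" "u \<in> U" "v \<in> U" "w \<in> U" "x (r k) \<otimes> u \<otimes> v = x (r n) \<otimes> w"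
      by (rule accumulating_translates[of "\<lambda>n. x (r n)", OF x(1)[rule_format] UY U1 tc acc])
    have "inv (x (r n)) \<otimes> x (r k) \<otimes> u \<otimes> v \<in> V0"
      using x(3) r(1) h 1(5) 2(5) unfolding U_def V_def strict_mono_def by blast
    moreover have "inv (x (r n)) \<otimes> x (r k) \<otimes> u \<otimes> v = inv (x (r n)) \<otimes> (x (r k) \<otimes> u \<otimes> v)"
      using h Uc x by (simp add: m_assoc subset_iff)
    moreover have "\<dots> = w" unfolding h(5) using h Uc x by (auto simp: subset_iff simp flip: m_assoc)
    ultimately show False using h UV0 unfolding U_def by auto
  qed
  then obtain n where n: "?Q (r n) \<inter> B \<noteq> {}" using t(2) AB by blast
  \<comment> \<open>Multiplying the two points cancels \<open>x (r n)\<close>: a product from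
    \<open>A B\<close>, hence in \<open>V\<close>, equals \<open>u \<otimes> v\<close>, an element
    of \<open>U0\<close>.\<close>
  obtain u v where uv: "u \<in> U" "v \<in> U" "u \<otimes> inv (x (r n)) \<in> A" "x (r n) \<otimes> v \<in> B"
    using n r(2)[of n] by blast
  have car: "u \<in> carrier K" "v \<in> carrier K" "x (r n) \<in> carrier K" using uv Uc x by auto
  then have "u \<otimes> inv (x (r n)) \<otimes> (x (r n) \<otimes> v) = u \<otimes> (inv (x (r n)) \<otimes> x (r n) \<otimes> v)"
    by (simp only: m_assoc m_closed inv_closed)
  also have "\<dots> = u \<otimes> v" using car by simp
  finally have "u \<otimes> v \<in> V" using AB(5)[rule_format, OF uv(3,4)] by (simp only:)
  moreover have "u \<otimes> v \<in> U0" using 4(5) uv unfolding U_def by blast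
  ultimately show False using UV0 unfolding V_def by blast
qed

end

section \<open>Semitopological orthogonal sums of Brandt semigroups\<close>

locale semitop_brandt_sum =
  fixes I :: "'i set" and \<Lambda> :: "'i \<Rightarrow> 'a set" and G :: "'i \<Rightarrow> 'g monoid"
    and T :: "('i, 'a, 'g) bel topology"
  assumes grp: "i \<in> I \<Longrightarrow> group (G i)"
    and carr: "topspace T = brandt_sum I \<Lambda> G"
    and semitop: "semitopological_semigroup T (bmult G)"
begin

section \<open>Two-sided translations and blocks\<close>

lemma hausdorff: "Hausdorff_space T"
  using semitop by (simp add: semitopological_semigroup_def)

lemma mult_assoc:
  "x \<in> topspace T \<Longrightarrow> y \<in> topspace T \<Longrightarrow> w \<in> topspace T \<Longrightarrow>
    bmult G (bmult G x y) w = bmult G x (bmult G y w)"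
  using semitop by (simp add: semitopological_semigroup_def)

lemma cont_mult:
  assumes "a \<in> topspace T"
  shows "continuous_map T T (\<lambda>x. bmult G a x)" "continuous_map T T (\<lambda>x. bmult G x a)"
  using semitop assms by (simp_all add: semitopological_semigroup_def)

lemma zero_in [simp]: "BZero \<in> topspace T"
  by (simp add: carr brandt_sum_def)

lemma BEl_in [simp]:
  "BEl i a g b \<in> topspace T \<longleftrightarrow> i \<in> I \<and> a \<in> \<Lambda> i \<and> b \<in> \<Lambda> i \<and> g \<in> carrier (G i)"
  by (simp add: carr brandt_sum_def)

lemma gblock_iff [simp]: "BEl j c g d \<in> gblock G i a b \<longleftrightarrow> j = i \<and> c = a \<and> d = b \<and> g \<in> carrier (G i)"
  by (auto simp: gblock_def)

lemma zero_notin_gblock [simp]: "BZero \<notin> gblock G i a b"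
  by (auto simp: gblock_def)

lemma gblock_subset: "i \<in> I \<Longrightarrow> a \<in> \<Lambda> i \<Longrightarrow> b \<in> \<Lambda> i \<Longrightarrow> gblock G i a b \<subseteq> topspace T"
  by (auto simp: gblock_def)

lemma mult_zero [simp]: "bmult G BZero x = BZero" "bmult G x BZero = BZero"
  by (cases x; simp)+

lemma one_in [simp]: "i \<in> I \<Longrightarrow> \<one>\<^bsub>G i\<^esub> \<in> carrier (G i)"
  using grp group.is_monoid monoid.one_closed by blast

text \<open>The middle factor comes last, so that partial application gives a self-map of the space.
  The retractions onto blocks with zero and the shifts between blocks all have this form.\<close>

definition sandwich where
  "sandwich p q s = bmult G (bmult G p s) q"

lemma sandwich_simps:
  "sandwich p q BZero = BZero"
  "sandwich (BEl i b x a) (BEl i c y d) (BEl j a' g c') =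
    (if j = i \<and> a' = a \<and> c' = c then BEl i b (x \<otimes>\<^bsub>G i\<^esub> g \<otimes>\<^bsub>G i\<^esub> y) d else BZero)"
  by (auto simp: sandwich_def)

lemma continuous_map_sandwich:
  assumes "p \<in> topspace T" "q \<in> topspace T"
  shows "continuous_map T T (sandwich p q)"
  using continuous_map_compose[OF cont_mult(1)[OF assms(1)] cont_mult(2)[OF assms(2)]]
  by (simp add: o_def sandwich_def[abs_def])

lemma open_sandwich_preimage:
  assumes "p \<in> topspace T" "q \<in> topspace T" "openin T U"
  shows "openin T {s \<in> topspace T. sandwich p q s \<in> U}"
  using continuous_map_sandwich[OF assms(1,2)] assms(3) by (rule openin_continuous_map_preimage)

text \<open>The inner indices \<open>b\<close> and \<open>c\<close> select one block; all else goes
  to zero, which lies in no block. Continuity then carries closedness from block to block.\<close>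

lemma gblock_eq_preimage:
  assumes "i \<in> I" "a \<in> \<Lambda> i" "b \<in> \<Lambda> i" "c \<in> \<Lambda> i" "d \<in> \<Lambda> i"
  shows "gblock G i b c =
    {s \<in> topspace T. sandwich (BEl i a \<one>\<^bsub>G i\<^esub> b) (BEl i c \<one>\<^bsub>G i\<^esub> d) s \<in> gblock G i a d}"
    (is "_ = ?R")
proof (rule Set.set_eqI)
  interpret group "G i" using grp assms(1) .
  fix s show "s \<in> gblock G i b c \<longleftrightarrow> s \<in> ?R"
    using assms by (cases s) (auto simp: sandwich_simps)
qed

lemma open_nonzero: "openin T (topspace T - {BZero})"
  by (intro openin_diff) (simp_all add: hausdorff closedin_Hausdorff_singleton)

text \<open>The idempotents at \<open>b\<close> and \<open>c\<close>, multiplied from the two sides,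
  kill everything outside this block, so it is the preimage of the open set of non-zero
  elements.\<close>

lemma open_gblock:
  assumes "i \<in> I" "b \<in> \<Lambda> i" "c \<in> \<Lambda> i"
  shows "openin T (gblock G i b c)"
proof -
  interpret group "G i" using grp assms(1) .
  have "gblock G i b c = {s \<in> topspace T.
      sandwich (BEl i b \<one>\<^bsub>G i\<^esub> b) (BEl i c \<one>\<^bsub>G i\<^esub> c) s \<in> topspace T - {BZero}}"
    (is "_ = ?R")
  proof (rule Set.set_eqI)
    fix s show "s \<in> gblock G i b c \<longleftrightarrow> s \<in> ?R"
      using assms by (cases s) (auto simp: sandwich_simps)
  qed
  then show ?thesis
    by (simp only:) (intro open_sandwich_preimage open_nonzero; use assms in simp)
qed

lemma closed_gblock_transfer:
  assumes "i \<in> I" "a \<in> \<Lambda> i" "b \<in> \<Lambda> i" "c \<in> \<Lambda> i" "d \<in> \<Lambda> i"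
    and "closedin T (gblock G i a d)"
  shows "closedin T (gblock G i b c)"
  unfolding gblock_eq_preimage[OF assms(1-5)]
  using continuous_map_sandwich assms(6)
  by (rule closedin_continuous_map_preimage) (use assms in simp_all)

lemma homeomorphic_maps_sandwich:
  assumes "i \<in> I" "a \<in> \<Lambda> i" "b \<in> \<Lambda> i" "c \<in> \<Lambda> i" "d \<in> \<Lambda> i"
  shows "homeomorphic_maps (subtopology T (gblock G i a b)) (subtopology T (gblock G i c d))
     (sandwich (BEl i c \<one>\<^bsub>G i\<^esub> a) (BEl i b \<one>\<^bsub>G i\<^esub> d))
     (sandwich (BEl i a \<one>\<^bsub>G i\<^esub> c) (BEl i d \<one>\<^bsub>G i\<^esub> b))"
proof -
  interpret group "G i" using grp assms(1) .
  have cont: "continuous_map (subtopology T (gblock G i a b)) (subtopology T (gblock G i c d))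
      (sandwich (BEl i c \<one>\<^bsub>G i\<^esub> a) (BEl i b \<one>\<^bsub>G i\<^esub> d))"
    if "a \<in> \<Lambda> i" "b \<in> \<Lambda> i" "c \<in> \<Lambda> i" "d \<in> \<Lambda> i" for a b c d
    unfolding continuous_map_in_subtopology
  proof
    show "continuous_map (subtopology T (gblock G i a b)) T
        (sandwich (BEl i c \<one>\<^bsub>G i\<^esub> a) (BEl i b \<one>\<^bsub>G i\<^esub> d))"
      using that assms(1) by (intro continuous_map_from_subtopology continuous_map_sandwich) simp_all
  qed (auto simp: gblock_def sandwich_simps)
  show ?thesis
    unfolding homeomorphic_maps_def
    using cont assms by (auto simp: gblock_def sandwich_simps)
qed

text \<open>Between \<open>x\<close> and \<open>y\<close> the product on the right has
  \<open>(a, 1, b)\<close> and \<open>(b, 1, a)\<close>, which multiply to the identity of the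
  subgroup.\<close>

lemma sandwich_mult:
  assumes "i \<in> I" "x \<in> gblock G i a a" "y \<in> gblock G i a a"
  shows "sandwich (BEl i b \<one>\<^bsub>G i\<^esub> a) (BEl i a \<one>\<^bsub>G i\<^esub> b) (bmult G x y) =
    bmult G (sandwich (BEl i b \<one>\<^bsub>G i\<^esub> a) (BEl i a \<one>\<^bsub>G i\<^esub> b) x)
      (sandwich (BEl i b \<one>\<^bsub>G i\<^esub> a) (BEl i a \<one>\<^bsub>G i\<^esub> b) y)"
proof -
  interpret group "G i" using grp assms(1) .
  show ?thesis using assms by (auto simp: gblock_def sandwich_simps)
qed

section \<open>Maximal subgroups and the adjoined zero\<close>

lemma semitopological_semigroup_gblock:
  assumes "i \<in> I" "a \<in> \<Lambda> i"
  shows "semitopological_semigroup (subtopology T (gblock G i a a)) (bmult G)"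
proof -
  interpret group "G i" using grp assms(1) .
  have top: "topspace (subtopology T (gblock G i a a)) = gblock G i a a"
    using gblock_subset assms by auto
  have sub: "x \<in> topspace T" if "x \<in> gblock G i a a" for x
    using gblock_subset assms that by blast
  have closed: "bmult G x y \<in> gblock G i a a" if "x \<in> gblock G i a a" "y \<in> gblock G i a a" for x y
    using that by (auto simp: gblock_def)
  show ?thesis
    unfolding semitopological_semigroup_def top
  proof (intro conjI ballI)
    fix x assume x: "x \<in> gblock G i a a"
    show "continuous_map (subtopology T (gblock G i a a)) (subtopology T (gblock G i a a)) (bmult G x)"
      "continuous_map (subtopology T (gblock G i a a)) (subtopology T (gblock G i a a)) (\<lambda>y. bmult G y x)"
      using closed x cont_mult[OF sub[OF x]]
      by (auto simp: continuous_map_in_subtopology continuous_map_from_subtopology)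
  qed (use hausdorff Hausdorff_space_subtopology closed sub mult_assoc in auto)
qed

text \<open>The record carries the product of the whole semigroup, so that multiplication by zero is
  available for \<open>group_with_zero_space\<close>.\<close>

definition max_subgroup :: "'i \<Rightarrow> 'a \<Rightarrow> ('i, 'a, 'g) bel monoid" where
  "max_subgroup i a = \<lparr>carrier = gblock G i a a, mult = bmult G, one = BEl i a \<one>\<^bsub>G i\<^esub> a\<rparr>"

lemma max_subgroup_simps [simp]:
  "carrier (max_subgroup i a) = gblock G i a a" "mult (max_subgroup i a) = bmult G"
  "one (max_subgroup i a) = BEl i a \<one>\<^bsub>G i\<^esub> a"
  by (simp_all add: max_subgroup_def)

lemma group_max_subgroup:
  assumes "i \<in> I"
  shows "group (max_subgroup i a)"
proof -
  interpret group "G i" using grp assms .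
  show ?thesis
  proof (rule groupI)
    fix x assume "x \<in> carrier (max_subgroup i a)"
    then obtain g where g: "x = BEl i a g a" "g \<in> carrier (G i)" by (auto simp: gblock_def)
    then show "\<exists>y\<in>carrier (max_subgroup i a). y \<otimes>\<^bsub>max_subgroup i a\<^esub> x = \<one>\<^bsub>max_subgroup i a\<^esub>"
      by (intro bexI[of _ "BEl i a (inv\<^bsub>G i\<^esub> g) a"]) simp_all
  qed (auto simp: gblock_def m_assoc)
qed

lemma group_with_zero_space_max_subgroup:
  assumes "i \<in> I" "a \<in> \<Lambda> i"
  shows "group_with_zero_space (max_subgroup i a) (subtopology T (insert BZero (gblock G i a a))) BZero"
proof -
  interpret K: group "max_subgroup i a" using group_max_subgroup assms(1) .
  let ?H = "insert BZero (gblock G i a a)"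
  have sub: "?H \<subseteq> topspace T" using gblock_subset assms by simp
  have cont: "continuous_map (subtopology T ?H) (subtopology T ?H) f"
    if "continuous_map T T f" "f ` ?H \<subseteq> ?H" for f
    using that by (auto simp: continuous_map_in_subtopology continuous_map_from_subtopology)
  show ?thesis
  proof unfold_locales
    show "topspace (subtopology T ?H) = insert BZero (carrier (max_subgroup i a))"
      using sub by auto
    fix x assume x: "x \<in> carrier (max_subgroup i a)"
    then have xT: "x \<in> topspace T" using sub by auto
    show "continuous_map (subtopology T ?H) (subtopology T ?H) (\<lambda>y. x \<otimes>\<^bsub>max_subgroup i a\<^esub> y)"
      using x K.m_closed[of x] by (intro cont) (auto simp: cont_mult[OF xT])
    show "continuous_map (subtopology T ?H) (subtopology T ?H) (\<lambda>y. y \<otimes>\<^bsub>max_subgroup i a\<^esub> x)"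
      using x K.m_closed[of _ x] by (intro cont) (auto simp: cont_mult[OF xT])
  qed (simp_all add: hausdorff Hausdorff_space_subtopology)
qed

lemma pseudocompact_group_with_zero:
  assumes "pseudocompact_space T" "i \<in> I" "a \<in> \<Lambda> i"
  shows "pseudocompact_space (subtopology T (insert BZero (gblock G i a a)))"
proof -
  interpret group "G i" using grp assms(2) .
  let ?H = "insert BZero (gblock G i a a)"
  let ?r = "sandwich (BEl i a \<one>\<^bsub>G i\<^esub> a) (BEl i a \<one>\<^bsub>G i\<^esub> a)"
  have sub: "?H \<subseteq> topspace T" using gblock_subset assms by simp
  have img: "?r ` topspace T \<subseteq> ?H"
  proof
    fix y assume "y \<in> ?r ` topspace T"
    then obtain s where "s \<in> topspace T" "y = ?r s" by blast
    then show "y \<in> ?H" by (cases s) (auto simp: sandwich_simps)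
  qed
  have fix_H: "?r s = s" if "s \<in> ?H" for s using that by (auto simp: gblock_def sandwich_simps)
  show ?thesis
  proof (rule pseudocompact_space_continuous_image[OF assms(1)])
    show "continuous_map T (subtopology T ?H) ?r"
      using img continuous_map_sandwich assms by (simp add: continuous_map_in_subtopology image_subset_iff_funcset)
    have "?H \<subseteq> ?r ` topspace T"
    proof
      fix s assume "s \<in> ?H"
      then have "s = ?r s" "s \<in> topspace T" using fix_H sub by (simp, blast)
      then show "s \<in> ?r ` topspace T" by (rule image_eqI)
    qed
    then have "?r ` topspace T = ?H" using img by (intro equalityI)
    then show "?r ` topspace T = topspace (subtopology T ?H)"
      by (simp only: topspace_subtopology_subset[OF sub])
  qed
qed

text \<open>With \<open>e\<close> the identity of the subgroup, the complement of the block consists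
  of the \<open>s\<close> with \<open>e s e = 0\<close>. As zero is isolated, this is the preimage
  of an open set.\<close>

lemma closed_group_if_isolated:
  assumes "i \<in> I" "a \<in> \<Lambda> i"
    and iso: "openin (subtopology T (insert BZero (gblock G i a a))) {BZero}"
  shows "closedin T (gblock G i a a)"
proof -
  let ?r = "sandwich (BEl i a \<one>\<^bsub>G i\<^esub> a) (BEl i a \<one>\<^bsub>G i\<^esub> a)"
  interpret group "G i" using grp assms(1) .
  obtain V where V: "openin T V" "{BZero} = V \<inter> insert BZero (gblock G i a a)"
    using iso by (auto simp: openin_subtopology)
  have "topspace T - gblock G i a a = {s \<in> topspace T. ?r s \<in> V}"
  proof (rule Set.set_eqI)
    have inV: "y \<in> V \<longleftrightarrow> y = BZero" if "y \<in> insert BZero (gblock G i a a)" for y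
      using V(2) that by blast
    fix s show "s \<in> topspace T - gblock G i a a \<longleftrightarrow> s \<in> {s \<in> topspace T. ?r s \<in> V}"
    proof (cases s)
      case BZero
      then show ?thesis using inV[of BZero] by (simp add: sandwich_simps)
    next
      case (BEl j c g d)
      then show ?thesis
        using inV[of "?r s"] assms by (auto simp: sandwich_simps)
    qed
  qed
  then have "openin T (topspace T - gblock G i a a)"
    using open_sandwich_preimage V assms by simp
  then show ?thesis using gblock_subset assms by (simp add: closedin_def)
qed

section \<open>Brandt summands and neighbourhood bases\<close>

lemma open_comp_diff:
  assumes "i \<in> I"
  shows "openin T (topspace T - brandt_comp \<Lambda> G i)"
    "openin T (brandt_comp \<Lambda> G i - {BZero})"
proof -
  \<comment> \<open>Zero belongs to the summand, so both differences are unions of open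
    blocks.\<close>
  have "topspace T - brandt_comp \<Lambda> G i = (\<Union>j\<in>I - {i}. \<Union>a\<in>\<Lambda> j. \<Union>b\<in>\<Lambda> j. gblock G j a b)"
    by (auto simp: carr brandt_sum_def brandt_comp_def gblock_def)
  moreover have "openin T \<dots>" by (intro openin_Union) (auto intro!: openin_Union open_gblock)
  ultimately show "openin T (topspace T - brandt_comp \<Lambda> G i)" by simp
  have "brandt_comp \<Lambda> G i - {BZero} = (\<Union>a\<in>\<Lambda> i. \<Union>b\<in>\<Lambda> i. gblock G i a b)"
    by (auto simp: brandt_comp_def gblock_def)
  moreover have "openin T \<dots>" using assms by (intro openin_Union) (auto intro!: openin_Union open_gblock)
  ultimately show "openin T (brandt_comp \<Lambda> G i - {BZero})" by simp
qed

text \<open>Collapsing all other summands to zero is a continuous retraction, although it is not a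
  translation.\<close>

lemma pseudocompact_comp:
  assumes "pseudocompact_space T" "i \<in> I"
  shows "pseudocompact_space (subtopology T (brandt_comp \<Lambda> G i))"
proof (rule pseudocompact_space_continuous_image[OF assms(1)])
  let ?C = "brandt_comp \<Lambda> G i"
  let ?r = "\<lambda>s. if s \<in> ?C then s else BZero"
  have sub: "?C \<subseteq> topspace T" and z: "BZero \<in> ?C"
    using assms(2) by (auto simp: carr brandt_sum_def brandt_comp_def)
  have "continuous_map T T ?r"
    unfolding continuous_map_def
  proof (intro conjI allI impI)
    show "?r \<in> topspace T \<rightarrow> topspace T" by auto
    fix U assume U: "openin T U"
    then have UT: "U \<subseteq> topspace T" by (rule openin_subset)
    show "openin T {s \<in> topspace T. ?r s \<in> U}"
    \<comment> \<open>Points outside the summand go to zero, so they belong to the preimage exactly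
      when zero is in \<open>U\<close>.\<close>
    proof (cases "BZero \<in> U")
      case True
      then have "{s \<in> topspace T. ?r s \<in> U} = U \<union> (topspace T - ?C)" using UT by auto
      then show ?thesis using U open_comp_diff(1)[OF assms(2)] by (simp add: openin_Un)
    next
      case False
      then have "{s \<in> topspace T. ?r s \<in> U} = U \<inter> (?C - {BZero})" using UT by auto
      then show ?thesis using U open_comp_diff(2)[OF assms(2)] by (simp add: openin_Int)
    qed
  qed
  then show "continuous_map T (subtopology T ?C) ?r"
    using z by (auto simp: continuous_map_in_subtopology)
  show "?r ` topspace T = topspace (subtopology T ?C)"
    using sub z by (auto simp: image_iff)
qed

text \<open>Continuity of \<open>?f\<close> makes the images small, and \<open>?h\<close>, built
  with the inverse of \<open>x\<close>, undoes \<open>?f\<close> on the subgroup, so the images are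
  open as preimages under \<open>?h\<close>.\<close>

lemma nbhd_base_translate:
  assumes i: "i \<in> I" and a: "a \<in> \<Lambda> i"
    and base: "nbhd_base T (BEl i a \<one>\<^bsub>G i\<^esub> a) \<B>" "\<forall>U\<in>\<B>. U \<subseteq> gblock G i a a"
    and b: "b \<in> \<Lambda> i" and c: "c \<in> \<Lambda> i" and x: "x \<in> carrier (G i)"
  shows "nbhd_base T (BEl i b x c)
    ((\<lambda>U. setmult (bmult G) (setmult (bmult G) {BEl i b x a} U) {BEl i a \<one>\<^bsub>G i\<^esub> c}) ` \<B>)"
proof -
  interpret group "G i" using grp i .
  let ?f = "sandwich (BEl i b x a) (BEl i a \<one>\<^bsub>G i\<^esub> c)"
  let ?h = "sandwich (BEl i a (inv\<^bsub>G i\<^esub> x) b) (BEl i c \<one>\<^bsub>G i\<^esub> a)"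
  have img: "setmult (bmult G) (setmult (bmult G) {BEl i b x a} U) {BEl i a \<one>\<^bsub>G i\<^esub> c} = ?f ` U" for U
    by (auto simp: setmult_def sandwich_def)
  have f1: "?f (BEl i a \<one>\<^bsub>G i\<^esub> a) = BEl i b x c" using x by (simp add: sandwich_simps)
  \<comment> \<open>The inclusion in the block matters: if zero lay in \<open>U\<close>, the
    preimage would contain everything that \<open>?h\<close> sends to zero.\<close>
  have eq: "?f ` U = {s \<in> topspace T. ?h s \<in> U}" if U: "U \<subseteq> gblock G i a a" for U
  proof
    show "?f ` U \<subseteq> {s \<in> topspace T. ?h s \<in> U}"
    proof
      fix y assume "y \<in> ?f ` U"
      then obtain s where s: "s \<in> U" "y = ?f s" by blast
      then obtain g where g: "s = BEl i a g a" "g \<in> carrier (G i)" using U by (auto simp: gblock_def)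
      have "?h y = s" "y \<in> topspace T"
        using s(2) g i b c x by (simp_all add: sandwich_simps flip: m_assoc)
      then show "y \<in> {s \<in> topspace T. ?h s \<in> U}" using s(1) by simp
    qed
    show "{s \<in> topspace T. ?h s \<in> U} \<subseteq> ?f ` U"
    proof
      fix s assume s: "s \<in> {s \<in> topspace T. ?h s \<in> U}"
      then have "?h s \<in> gblock G i a a" using U by blast
      then obtain g where g: "s = BEl i b g c" "g \<in> carrier (G i)"
        using s by (cases s) (auto simp: sandwich_simps split: if_splits)
      then have "?f (?h s) = s" using x by (simp add: sandwich_simps flip: m_assoc)
      then show "s \<in> ?f ` U" using s by (intro image_eqI[of s ?f "?h s"]) simp_all
    qed
  qed
  show ?thesis
    unfolding nbhd_base_def img
  proof (intro conjI ballI allI impI)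
    fix B assume "B \<in> (`) ?f ` \<B>"
    then obtain U where U: "U \<in> \<B>" "B = ?f ` U" by blast
    then have "openin T U" "BEl i a \<one>\<^bsub>G i\<^esub> a \<in> U" using base(1) by (auto simp: nbhd_base_def)
    moreover have "B = {s \<in> topspace T. ?h s \<in> U}" using U eq base(2) by simp
    ultimately show "openin T B" using i a b c x by (simp add: open_sandwich_preimage)
    have "?f (BEl i a \<one>\<^bsub>G i\<^esub> a) \<in> ?f ` U"
      using \<open>BEl i a \<one>\<^bsub>G i\<^esub> a \<in> U\<close> by (rule imageI)
    then show "BEl i b x c \<in> B" by (simp only: f1 U(2))
  next
    fix W assume W: "openin T W \<and> BEl i b x c \<in> W"
    have "openin T {s \<in> topspace T. ?f s \<in> W}"
      using W i a b c x by (intro open_sandwich_preimage) simp_all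
    moreover have "BEl i a \<one>\<^bsub>G i\<^esub> a \<in> {s \<in> topspace T. ?f s \<in> W}" using W f1 i a by simp
    ultimately have "\<exists>U\<in>\<B>. U \<subseteq> {s \<in> topspace T. ?f s \<in> W}"
      using base(1) by (simp add: nbhd_base_def)
    then obtain U where "U \<in> \<B>" "U \<subseteq> {s \<in> topspace T. ?f s \<in> W}" ..
    then show "\<exists>B\<in>(`) ?f ` \<B>. B \<subseteq> W" by (intro bexI[of _ "?f ` U"]) auto
  qed
qed

text \<open>For a regular open neighbourhood \<open>V\<close> of zero, a block not contained in \<open>V\<close> is not even
  contained in the closure of \<open>V\<close>; the differences form a locally finite family.\<close>

lemma nbhd_base_zero:
  assumes pc: "pseudocompact_space T" and sr: "semiregular_space T"
    and closed: "\<And>i a b. i \<in> I \<Longrightarrow> a \<in> \<Lambda> i \<Longrightarrow> b \<in> \<Lambda> i \<Longrightarrow> closedin T (gblock G i a b)"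
  shows "nbhd_base T BZero {brandt_sum I \<Lambda> G - \<Union>\<F> | \<F>. finite \<F> \<and>
    \<F> \<subseteq> {gblock G i a b | i a b. i \<in> I \<and> a \<in> \<Lambda> i \<and> b \<in> \<Lambda> i}}"
proof -
  define Bl where "Bl = {gblock G i a b | i a b. i \<in> I \<and> a \<in> \<Lambda> i \<and> b \<in> \<Lambda> i}"
  have Bl: "openin T B" "closedin T B" "BZero \<notin> B" if "B \<in> Bl" for B
    using that open_gblock closed by (auto simp: Bl_def)
  have disj: "B = C" if "B \<in> Bl" "C \<in> Bl" "s \<in> B" "s \<in> C" for B C s
    using that by (auto simp: Bl_def gblock_def)
  have cover: "\<exists>B\<in>Bl. s \<in> B" if "s \<in> topspace T" "s \<noteq> BZero" for s
  proof (cases s)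
    case (BEl i a g b)
    then have "gblock G i a b \<in> Bl" "s \<in> gblock G i a b" using that by (auto simp: Bl_def)
    then show ?thesis by blast
  qed (use that in simp)
  show ?thesis
    unfolding nbhd_base_def Bl_def[symmetric]
  proof (intro conjI ballI allI impI)
    fix N assume "N \<in> {brandt_sum I \<Lambda> G - \<Union>\<F> |\<F>. finite \<F> \<and> \<F> \<subseteq> Bl}"
    then obtain \<F> where F: "finite \<F>" "\<F> \<subseteq> Bl" "N = topspace T - \<Union>\<F>" by (auto simp: carr)
    have "closedin T (\<Union>\<F>)" using F Bl by (intro closedin_Union) auto
    then show "openin T N" using F(3) by blast
    show "BZero \<in> N" using F Bl(3) by auto
  next
    fix U assume "openin T U \<and> BZero \<in> U"
    then obtain V where V: "openin T V" "BZero \<in> V" "V \<subseteq> U" "T interior_of (T closure_of V) = V"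
      using sr unfolding semiregular_space_def by meson
    define \<F> where "\<F> = {B \<in> Bl. \<not> B \<subseteq> V}"
    \<comment> \<open>A block is open, so if it were inside the closure of \<open>V\<close> it would
      be inside the interior of that closure, which is \<open>V\<close>.\<close>
    have ne: "B - T closure_of V \<noteq> {}" if "B \<in> \<F>" for B
    proof
      assume "B - T closure_of V = {}"
      then have "B \<subseteq> T interior_of (T closure_of V)"
        using that Bl(1) by (intro interior_of_maximal) (auto simp: \<F>_def)
      then show False using that V(4) by (simp add: \<F>_def)
    qed
    let ?d = "\<lambda>B. B - T closure_of V"
    have "finite (?d ` \<F>)"
    proof (rule pc[unfolded pseudocompact_space_def, rule_format], intro conjI ballI)
      fix W assume "W \<in> ?d ` \<F>"
      then obtain B where B: "B \<in> \<F>" "W = ?d B" by blast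
      show "openin T W" unfolding B(2) using B(1) Bl(1) by (intro openin_diff) (auto simp: \<F>_def)
      show "W \<noteq> {}" using ne B by simp
    next
      show "locally_finite_in T (?d ` \<F>)"
        unfolding locally_finite_in_def
      proof (intro conjI ballI)
        show "\<Union>(?d ` \<F>) \<subseteq> topspace T"
          using Bl(1) openin_subset by (fastforce simp: \<F>_def)
        fix s assume s: "s \<in> topspace T"
        show "\<exists>N. openin T N \<and> s \<in> N \<and> finite {W \<in> ?d ` \<F>. W \<inter> N \<noteq> {}}"
        \<comment> \<open>Around zero, \<open>V\<close> meets no difference; around any other point,
          its own block meets at most one, blocks being disjoint.\<close>
        proof (cases "s = BZero")
          case True
          have "{W \<in> ?d ` \<F>. W \<inter> V \<noteq> {}} = {}"
            using closure_of_subset[OF openin_subset[OF V(1)]] by auto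
          then have "finite {W \<in> ?d ` \<F>. W \<inter> V \<noteq> {}}" by (simp only: finite.emptyI)
          then show ?thesis using V True by (intro exI[of _ V]) simp
        next
          case False
          then obtain B where B: "B \<in> Bl" "s \<in> B" using cover s by blast
          have "{W \<in> ?d ` \<F>. W \<inter> B \<noteq> {}} \<subseteq> {?d B}"
          proof
            fix W assume "W \<in> {W \<in> ?d ` \<F>. W \<inter> B \<noteq> {}}"
            then obtain C t where C: "C \<in> Bl" "W = ?d C" "t \<in> C" "t \<in> B" by (auto simp: \<F>_def)
            then show "W \<in> {?d B}" using disj[OF C(1) B(1) C(3,4)] by simp
          qed
          then have "finite {W \<in> ?d ` \<F>. W \<inter> B \<noteq> {}}" by (rule finite_subset) simp
          then show ?thesis using B Bl(1) by (intro exI[of _ B]) simp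
        qed
      qed
    qed
    \<comment> \<open>Pseudocompactness bounds only the set of differences; as non-empty parts of
      disjoint blocks they determine their blocks.\<close>
    moreover have "inj_on ?d \<F>"
    proof (rule inj_onI)
      fix B C assume BC: "B \<in> \<F>" "C \<in> \<F>" "?d B = ?d C"
      then obtain s where "s \<in> ?d B" "s \<in> ?d C" using ne by blast
      then have "s \<in> B" "s \<in> C" by blast+
      then show "B = C" using BC(1,2) disj[of B C s] by (simp add: \<F>_def)
    qed
    ultimately have fin: "finite \<F>" using finite_imageD by blast
    have "topspace T - \<Union>\<F> \<subseteq> U"
    proof
      fix s assume s: "s \<in> topspace T - \<Union>\<F>"
      show "s \<in> U"
      proof (cases "s = BZero")
        case False
        then obtain B where "B \<in> Bl" "s \<in> B" using cover s by blast
        then show ?thesis using s V(3) by (auto simp: \<F>_def)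
      qed (use V in auto)
    qed
    moreover have "topspace T - \<Union>\<F> \<in> {brandt_sum I \<Lambda> G - \<Union>\<F> |\<F>. finite \<F> \<and> \<F> \<subseteq> Bl}"
      using fin by (intro CollectI exI[of _ \<F>]) (simp add: carr \<F>_def)
    ultimately show "\<exists>N\<in>{brandt_sum I \<Lambda> G - \<Union>\<F> |\<F>. finite \<F> \<and> \<F> \<subseteq> Bl}. N \<subseteq> U"
      by (rule bexI)
  qed
qed

section \<open>From the four alternatives to the conclusions\<close>

lemma closed_max_subgroup:
  assumes pc: "pseudocompact_space T" and i: "i \<in> I" and a: "a \<in> \<Lambda> i"
    and cond: "left_precompact T (gblock G i a a) (bmult G) (BEl i a \<one>\<^bsub>G i\<^esub> a)
      \<or> (topological_semigroup (subtopology T (gblock G i a a)) (bmult G)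
          \<and> pseudocompact_space (subtopology T (gblock G i a a)))
      \<or> (left_omega_precompact T (gblock G i a a) (bmult G) (BEl i a \<one>\<^bsub>G i\<^esub> a)
          \<and> pseudocompact_space (subtopology T (gblock G i a a)))
      \<or> topological_semigroup (subtopology T (insert BZero (gblock G i a a))) (bmult G)"
  shows "closedin T (gblock G i a a)"
proof (rule closed_group_if_isolated[OF i a])
  let ?X = "subtopology T (insert BZero (gblock G i a a))"
  interpret Z: group_with_zero_space "max_subgroup i a" ?X BZero
    using group_with_zero_space_max_subgroup i a .
  \<comment> \<open>The isolation criteria view the group inside the group with zero, the hypotheses
    view it inside \<open>T\<close>; the topologies agree.\<close>
  have sub: "subtopology ?X (gblock G i a a) = subtopology T (gblock G i a a)"
    by (simp add: subtopology_subtopology Int_absorb1 subset_insertI)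
  show "openin ?X {BZero}"
    using cond
  proof (elim disjE conjE)
    assume "left_precompact T (gblock G i a a) (bmult G) (BEl i a \<one>\<^bsub>G i\<^esub> a)"
    then show ?thesis
      by (intro Z.isolated_if_left_precompact) (simp add: left_precompact_def sub)
  next
    assume "topological_semigroup (subtopology T (gblock G i a a)) (bmult G)"
      and "pseudocompact_space (subtopology T (gblock G i a a))"
    then show ?thesis
      by (intro Z.isolated_if_paratopological) (simp_all add: topological_semigroup_def sub)
  next
    assume "left_omega_precompact T (gblock G i a a) (bmult G) (BEl i a \<one>\<^bsub>G i\<^esub> a)"
      and "pseudocompact_space (subtopology T (gblock G i a a))"
    then show ?thesis
      by (intro Z.isolated_if_left_omega_precompact) (simp_all add: left_omega_precompact_def sub)
  next
    assume "topological_semigroup ?X (bmult G)"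
    then show ?thesis
      \<comment> \<open>In this case pseudocompactness of the group with zero comes from the
        retraction of \<open>T\<close>.\<close>
      using pseudocompact_group_with_zero[OF pc i a]
      by (intro Z.isolated_if_topological_semigroup) (simp_all add: topological_semigroup_def)
  qed
qed

end

theorem theorem2p12:
  fixes I :: "'i set" and \<Lambda> :: "'i \<Rightarrow> 'a set" and G :: "'i \<Rightarrow> 'g monoid"
    and T :: "('i, 'a, 'g) bel topology" and \<alpha> :: "'i \<Rightarrow> 'a"
  assumes grp: "\<forall>i\<in>I. group (G i)"
    and lam: "\<forall>i\<in>I. \<Lambda> i \<noteq> {}"
    and carr: "topspace T = brandt_sum I \<Lambda> G"
    and semitop: "semitopological_semigroup T (bmult G)"
    and pc: "pseudocompact_space T"
    and alpha: "\<forall>i\<in>I. \<alpha> i \<in> \<Lambda> i"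
    and cond: "\<forall>i\<in>I.
        left_precompact T (gblock G i (\<alpha> i) (\<alpha> i)) (bmult G) (BEl i (\<alpha> i) \<one>\<^bsub>G i\<^esub> (\<alpha> i))
      \<or> (topological_semigroup (subtopology T (gblock G i (\<alpha> i) (\<alpha> i))) (bmult G)
          \<and> pseudocompact_space (subtopology T (gblock G i (\<alpha> i) (\<alpha> i))))
      \<or> (left_omega_precompact T (gblock G i (\<alpha> i) (\<alpha> i)) (bmult G) (BEl i (\<alpha> i) \<one>\<^bsub>G i\<^esub> (\<alpha> i))
          \<and> pseudocompact_space (subtopology T (gblock G i (\<alpha> i) (\<alpha> i))))
      \<or> topological_semigroup (subtopology T (insert BZero (gblock G i (\<alpha> i) (\<alpha> i)))) (bmult G)"
  shows
    \<comment> \<open>(i)\<close>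
    "(\<forall>i\<in>I. \<forall>a\<in>\<Lambda> i.
        openin T (gblock G i a a) \<and> closedin T (gblock G i a a)
        \<and> pseudocompact_space (subtopology T (gblock G i a a)))
     \<comment> \<open>(ii)\<close>
     \<and> (\<forall>i\<in>I.
        pseudocompact_space (subtopology T (brandt_comp \<Lambda> G i))
        \<and> (\<forall>a\<in>\<Lambda> i. \<forall>b\<in>\<Lambda> i. \<forall>c\<in>\<Lambda> i. \<forall>d\<in>\<Lambda> i.
             subtopology T (gblock G i a b) homeomorphic_space subtopology T (gblock G i c d))
        \<and> (\<forall>a\<in>\<Lambda> i.
             semitopological_semigroup (subtopology T (gblock G i a a)) (bmult G)
             \<and> pseudocompact_space (subtopology T (gblock G i a a)))
        \<and> (\<forall>a\<in>\<Lambda> i. \<forall>b\<in>\<Lambda> i.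
             \<exists>f. homeomorphic_map (subtopology T (gblock G i a a)) (subtopology T (gblock G i b b)) f
               \<and> (\<forall>x\<in>gblock G i a a. \<forall>y\<in>gblock G i a a. f (bmult G x y) = bmult G (f x) (f y))))
     \<comment> \<open>(iii)\<close>
     \<and> (\<forall>i\<in>I. \<forall>\<B>.
        nbhd_base T (BEl i (\<alpha> i) \<one>\<^bsub>G i\<^esub> (\<alpha> i)) \<B> \<and> (\<forall>U\<in>\<B>. U \<subseteq> gblock G i (\<alpha> i) (\<alpha> i)) \<longrightarrow>
        (\<forall>b\<in>\<Lambda> i. \<forall>c\<in>\<Lambda> i. \<forall>x\<in>carrier (G i).
           nbhd_base T (BEl i b x c)
             ((\<lambda>U. setmult (bmult G) (setmult (bmult G) {BEl i b x (\<alpha> i)} U) {BEl i (\<alpha> i) \<one>\<^bsub>G i\<^esub> c}) ` \<B>)))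
     \<comment> \<open>(iv)\<close>
     \<and> (semiregular_space T \<longrightarrow>
        nbhd_base T BZero
          {brandt_sum I \<Lambda> G - \<Union>\<F> | \<F>. finite \<F> \<and>
             \<F> \<subseteq> {gblock G i a b | i a b. i \<in> I \<and> a \<in> \<Lambda> i \<and> b \<in> \<Lambda> i}})"
proof -
  interpret semitop_brandt_sum I \<Lambda> G T
    using grp carr semitop by (intro semitop_brandt_sum.intro) auto
  \<comment> \<open>One closed block per summand suffices: the hypothesis gives the one at
    \<open>\<alpha> i\<close>, and the other blocks are its preimages.\<close>
  have closed: "closedin T (gblock G i a b)" if "i \<in> I" "a \<in> \<Lambda> i" "b \<in> \<Lambda> i" for i a b
    using closed_gblock_transfer[of i "\<alpha> i" a b "\<alpha> i"] closed_max_subgroup[OF pc, of i "\<alpha> i"]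
      that alpha cond by blast
  have pcg: "pseudocompact_space (subtopology T (gblock G i a a))" if "i \<in> I" "a \<in> \<Lambda> i" for i a
    using that pc closed open_gblock by (intro pseudocompact_space_clopen_subtopology) simp_all
  show ?thesis
  proof (intro conjI ballI impI allI)
    fix i a b c d assume "i \<in> I" "a \<in> \<Lambda> i" "b \<in> \<Lambda> i" "c \<in> \<Lambda> i" "d \<in> \<Lambda> i"
    then show "subtopology T (gblock G i a b) homeomorphic_space subtopology T (gblock G i c d)"
      unfolding homeomorphic_space_def using homeomorphic_maps_sandwich by blast
  next
    fix i a b assume i: "i \<in> I" "a \<in> \<Lambda> i" "b \<in> \<Lambda> i"
    let ?f = "sandwich (BEl i b \<one>\<^bsub>G i\<^esub> a) (BEl i a \<one>\<^bsub>G i\<^esub> b)"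
    have "homeomorphic_map (subtopology T (gblock G i a a)) (subtopology T (gblock G i b b)) ?f"
      using homeomorphic_maps_sandwich[of i a a b b] i homeomorphic_map_maps by blast
    then show "\<exists>f. homeomorphic_map (subtopology T (gblock G i a a)) (subtopology T (gblock G i b b)) f
        \<and> (\<forall>x\<in>gblock G i a a. \<forall>y\<in>gblock G i a a. f (bmult G x y) = bmult G (f x) (f y))"
      using i by (intro exI[of _ ?f] conjI ballI sandwich_mult)
  next
    fix i \<B> b c x
    assume "i \<in> I" "nbhd_base T (BEl i (\<alpha> i) \<one>\<^bsub>G i\<^esub> (\<alpha> i)) \<B> \<and> (\<forall>U\<in>\<B>. U \<subseteq> gblock G i (\<alpha> i) (\<alpha> i))"
      and "b \<in> \<Lambda> i" "c \<in> \<Lambda> i" "x \<in> carrier (G i)"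
    then show "nbhd_base T (BEl i b x c)
        ((\<lambda>U. setmult (bmult G) (setmult (bmult G) {BEl i b x (\<alpha> i)} U) {BEl i (\<alpha> i) \<one>\<^bsub>G i\<^esub> c}) ` \<B>)"
      using alpha by (intro nbhd_base_translate) simp_all
  next
    assume "semiregular_space T"
    then show "nbhd_base T BZero {brandt_sum I \<Lambda> G - \<Union>\<F> | \<F>. finite \<F> \<and>
        \<F> \<subseteq> {gblock G i a b | i a b. i \<in> I \<and> a \<in> \<Lambda> i \<and> b \<in> \<Lambda> i}}"
      by (intro nbhd_base_zero pc closed)
  qed (simp_all add: open_gblock closed pcg pc pseudocompact_comp semitopological_semigroup_gblock)
qed

end
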